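(* Let $\{X_i\}_{i\geq 1}$ be a time-homogeneous Markov chain on $(\mathcal{X},\mathcal{B})$ with invariant probability measure $\pi$ and absolute spectral gap $1-\lambda>0$. Then for any $n\ge 1$ and any bounded measurable functions $f_i:\mathcal{X}\to[a_i,b_i]$, $i=1,\dots,n$, when the chain starts from $X_1\sim\pi$ the sum $\sum_{i=1}^n f_i(X_i)$ is sub-Gaussian with variance proxy $\alpha(\lambda)\cdot\sum_{i=1}^n (b_i-a_i)^2/4$; that is, for any $t\in\mathbb{R}$, $$\mathbb{E}_\pi\left[e^{t\sum_{i=1}^n (f_i(X_i)-\pi(f_i))}\right]\leq \exp\left(\frac{t^2}{2}\cdot\alpha(\lambda)\cdot\sum_{i=1}^n\frac{(b_i-a_i)^2}{4}\right).$$ It follows that for any $\epsilon>0$, $$\mathbb{P}_\pi\left(\left|\sum_{i=1}^n f_i(X_i)-\sum_{i=1}^n\pi(f_i)\right|>\epsilon\right)\leq 2\exp\left(-\frac{\alpha(\lambda)^{-1}\epsilon^2}{2\sum_{i=1}^n (b_i-a_i)^2/4}\right).$$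
   Context: The state space $(\mathcal{X},\mathcal{B})$ is a standard Borel space. A transition kernel $P$ is invariant with a probability measure $\pi$ if $\pi(B)=\int P(x,B)\,\pi(dx)$ for all $B\in\mathcal{B}$. $\mathcal{L}_2(\pi)$ is the real Hilbert space of $\pi$-square-integrable measurable real functions on $\mathcal{X}$, with norm $\|h\|_\pi=\pi(h^2)^{1/2}$, where $\pi(h):=\int h\,d\pi$. The kernel acts on $\mathcal{L}_2(\pi)$ as the Markov operator $Ph(x)=\int h(y)P(x,dy)$. The chain (kernel) admits absolute spectral gap $1-\lambda$ if $\lambda:=\sup\{\|Ph\|_\pi:\|h\|_\pi=1,\ \pi(h)=0\}<1$. The chain is not assumed reversible. $\mathbb{E}_\pi$, $\mathbb{P}_\pi$ denote expectation and probability when $X_1\sim\pi$. $\alpha(\lambda)=\frac{1+\lambda}{1-\lambda}$. A random variable $Z$ is sub-Gaussian with variance proxy $\sigma^2$ if it has finite mean and $\mathbb{E}[e^{t(Z-\mathbb{E}Z)}]\le\exp(\sigma^2t^2/2)$ for all $t\in\mathbb{R}$. *)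

theory Defs
  imports "HOL-Probability.Probability"
begin

text \<open>
  A measurable space is represented, as in the library, by a measure \<open>B\<close> of which only
  \<^term>\<open>space B\<close> and \<^term>\<open>sets B\<close> matter. It is standard Borel if its sigma-algebra is the
  Borel sigma-algebra of some Polish topology on \<^term>\<open>space B\<close>.
\<close>

definition standard_borel_space :: "'a measure \<Rightarrow> bool" where
  "standard_borel_space B \<longleftrightarrow>
     (\<exists>T. topspace T = space B \<and> completely_metrizable_space T \<and> separable_space T \<and>
          sets B = sigma_sets (topspace T) {U. openin T U})"

definition transition_kernel :: "'a measure \<Rightarrow> ('a \<Rightarrow> 'a measure) \<Rightarrow> bool" where
  "transition_kernel B P \<longleftrightarrow> P \<in> measurable B (prob_algebra B)"

definition invariant_prob_measure ::
    "'a measure \<Rightarrow> ('a \<Rightarrow> 'a measure) \<Rightarrow> 'a measure \<Rightarrow> bool" where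
  "invariant_prob_measure B P \<pi> \<longleftrightarrow>
     prob_space \<pi> \<and> sets \<pi> = sets B \<and>
     (\<forall>A\<in>sets B. emeasure \<pi> A = (\<integral>\<^sup>+ x. emeasure (P x) A \<partial>\<pi>))"

definition L2_functions :: "'a measure \<Rightarrow> ('a \<Rightarrow> real) set" where
  "L2_functions \<pi> = {h \<in> borel_measurable \<pi>. integrable \<pi> (\<lambda>x. (h x)\<^sup>2)}"

definition L2_norm :: "'a measure \<Rightarrow> ('a \<Rightarrow> real) \<Rightarrow> real" where
  "L2_norm \<pi> h = sqrt (\<integral>x. (h x)\<^sup>2 \<partial>\<pi>)"

definition markov_operator :: "('a \<Rightarrow> 'a measure) \<Rightarrow> ('a \<Rightarrow> real) \<Rightarrow> 'a \<Rightarrow> real" where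
  "markov_operator P h x = (\<integral>y. h y \<partial>P x)"

text \<open>
  The constant \<open>\<lambda>\<close> whose complement \<open>1 - \<lambda>\<close> is the absolute spectral gap. The supremum is taken
  in the nonnegative reals: inserting \<open>0\<close> only matters when no mean-zero function has norm 1
  (for instance when \<open>\<pi>\<close> is a Dirac measure), where it fixes the supremum of the empty set to
  be \<open>0\<close>. For invariant \<open>\<pi>\<close> the set is bounded above by \<open>1\<close>, because \<open>P\<close> is a contraction
  of \<open>L2(\<pi>)\<close>, so this is a genuine supremum.
\<close>

definition spectral_lambda :: "('a \<Rightarrow> 'a measure) \<Rightarrow> 'a measure \<Rightarrow> real" where
  "spectral_lambda P \<pi> =
     Sup (insert 0 {L2_norm \<pi> (markov_operator P h) | h.
                      h \<in> L2_functions \<pi> \<and> L2_norm \<pi> h = 1 \<and> (\<integral>x. h x \<partial>\<pi>) = 0})"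

definition alpha :: "real \<Rightarrow> real" where
  "alpha l = (1 + l) / (1 - l)"

definition natural_filtration ::
    "'w measure \<Rightarrow> 'a measure \<Rightarrow> (nat \<Rightarrow> 'w \<Rightarrow> 'a) \<Rightarrow> nat \<Rightarrow> 'w measure" where
  "natural_filtration M B X i =
     sigma (space M) (\<Union>j\<in>{1..i}. {X j -` A \<inter> space M | A. A \<in> sets B})"

text \<open>
  The process is indexed by \<open>i \<ge> 1\<close>; the value \<open>X 0\<close> is irrelevant. Time-homogeneity is the
  fact that the same kernel \<open>P\<close> is used at every step; the initial law is unconstrained.
\<close>

definition markov_chain ::
    "'w measure \<Rightarrow> 'a measure \<Rightarrow> ('a \<Rightarrow> 'a measure) \<Rightarrow> (nat \<Rightarrow> 'w \<Rightarrow> 'a) \<Rightarrow> bool" where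
  "markov_chain M B P X \<longleftrightarrow>
     prob_space M \<and> transition_kernel B P \<and>
     (\<forall>i\<ge>1. X i \<in> measurable M B) \<and>
     (\<forall>i\<ge>1. \<forall>A\<in>sets B. AE w in M.
        real_cond_exp M (natural_filtration M B X i)
          (indicator (X (Suc i) -` A \<inter> space M)) w = measure (P (X i w)) A)"

text \<open>
  Integrability of the exponential is explicit because the Bochner integral of a
  non-integrable function is \<open>0\<close>; without it the inequality would not bound the moment
  generating function.
\<close>

definition sub_gaussian :: "'w measure \<Rightarrow> ('w \<Rightarrow> real) \<Rightarrow> real \<Rightarrow> bool" where
  "sub_gaussian M Z v \<longleftrightarrow>
     integrable M Z \<and>
     (\<forall>t. integrable M (\<lambda>w. exp (t * (Z w - (\<integral>w'. Z w' \<partial>M)))) \<and>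
          (\<integral>w. exp (t * (Z w - (\<integral>w'. Z w' \<partial>M))) \<partial>M) \<le> exp (v * t\<^sup>2 / 2))"

end

theory Submission
  imports Defs
begin

text \<open>
  Write \<open>Q v = \<lambda> \<pi>(v\<^sup>2) + (1 - \<lambda>) \<pi>(v)\<^sup>2\<close> for the quadratic form of the Leon-Perron operator. The spectral
  gap gives \<open>\<pi>(g P h)\<^sup>2 \<le> Q g Q h\<close>, so \<open>P\<close> may be replaced by that self-adjoint operator. For mean-zero
  \<open>f\<close> with values in \<open>[a, b]\<close> one has \<open>Q v \<le> C \<pi>(v\<^sup>2 e\<^sup>-\<^sup>t\<^sup>f)\<close> with \<open>C = exp (\<alpha> t\<^sup>2 (b - a)\<^sup>2 / 8)\<close>: since
  \<open>Q\<close> is a multiple of the identity plus a rank-one form, this amounts by Cauchy-Schwarz to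
  \<open>(1 - \<lambda>) \<pi>(1 / (C e\<^sup>-\<^sup>t\<^sup>f - \<lambda>)) \<le> 1\<close>, and convexity reduces this to laws supported on \<open>{a, b}\<close>, where
  it is an inequality between hyperbolic functions. Applying both estimates along the backward
  recursion \<open>g\<^sub>i = e\<^sup>t\<^sup>f P g\<^sub>i\<^sub>+\<^sub>1\<close> bounds the moment generating function by the product of the constants
  \<open>C\<close>, and the tail bound is Chernoff's inequality.
\<close>

section \<open>The two-point inequality\<close>

lemma sinh_le_mult_cosh:
  fixes x :: real
  assumes "0 \<le> x"
  shows "sinh x \<le> x * cosh x"
proof -
  have "(\<lambda>x. x * cosh x - sinh x) 0 \<le> (\<lambda>x. x * cosh x - sinh x) x"
  proof (rule DERIV_nonneg_imp_nondecreasing[OF assms])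
    fix y :: real
    assume "0 \<le> y"
    then show "\<exists>D. ((\<lambda>x. x * cosh x - sinh x) has_real_derivative D) (at y) \<and> 0 \<le> D"
      by (intro exI[of _ "y * sinh y"]) (auto intro!: derivative_eq_intros)
  qed
  then show ?thesis
    by simp
qed

text \<open>Hoeffding's lemma for a fair sign, whose moment generating function is
  \<open>cosh\<close>: the library's auxiliary estimate is taken with probability 1/2 and interval
  length \<open>2 * x\<close>.\<close>

lemma cosh_le_exp_half_square: "cosh (x::real) \<le> exp (x\<^sup>2 / 2)"
proof -
  have *: "cosh x \<le> exp (x\<^sup>2 / 2)" if "0 < x" for x :: real
  proof -
    have "exp (2 * x) > 1"
      using that by simp
    then have pos: "1 + 1 / 2 * (exp (2 * x) - 1) > 0"
      by (smt (verit) half_gt_zero mult_nonneg_nonneg)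
    have "- (2 * x) * (1 / 2) + ln (1 + 1 / 2 * (exp (2 * x) - 1)) \<le> (2 * x)\<^sup>2 / 8"
      using that by (intro Hoeffdings_lemma_aux) auto
    then have "exp (- x + ln (1 + 1 / 2 * (exp (2 * x) - 1))) \<le> exp (x\<^sup>2 / 2)"
      by (simp add: power2_eq_square)
    moreover have "exp (- x + ln (1 + 1 / 2 * (exp (2 * x) - 1))) = exp (- x) * (1 + 1 / 2 * (exp (2 * x) - 1))"
      using pos by (simp only: exp_add exp_ln)
    moreover have "\<dots> = cosh x"
      using exp_add[of "- x" "2 * x"] by (simp add: cosh_field_def algebra_simps)
    ultimately show ?thesis
      by linarith
  qed
  show ?thesis
    using *[of x] *[of "- x"] by (cases "x = 0") force+
qed

text \<open>Convexity of \<open>cosh\<close>, obtained by averaging the tangent bounds of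
  \<open>exp\<close> at \<open>z\<close> and at \<open>- z\<close>.\<close>

lemma cosh_ge_tangent: "cosh z + (y - z) * sinh z \<le> cosh (y::real)"
proof -
  have "exp z * (1 + (y - z)) \<le> exp z * exp (y - z)"
    by (intro mult_left_mono) auto
  moreover have "exp (- z) * (1 + (z - y)) \<le> exp (- z) * exp (z - y)"
    using exp_ge_add_one_self[of "z - y"] by (intro mult_left_mono) auto
  ultimately show ?thesis
    by (simp add: cosh_field_def sinh_field_def flip: exp_add) (simp add: field_simps)
qed

text \<open>
  This is the worst case over the slope \<open>u\<close> of the inequality that follows it, at the point where
  \<open>sinh y = S x\<close>. The difference \<open>F\<close> of the two sides vanishes as \<open>x \<rightarrow> 0\<close> and is increasing, because
  the terms without \<open>S'\<close> cancel in \<open>F'\<close>.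
\<close>

lemma cosh_le_legendre:
  fixes d x :: real
  defines "S \<equiv> \<lambda>x. sinh d * sinh x / x"
  assumes d: "0 < d" and x: "0 < x"
  shows "cosh d * cosh x
    \<le> sqrt ((S x)\<^sup>2 + 1) + (cosh d / sinh d * x\<^sup>2 / 2 + d - arsinh (S x)) * S x"
proof -
  define F where "F = (\<lambda>x. sqrt ((S x)\<^sup>2 + 1)
    + (cosh d / sinh d * x\<^sup>2 / 2 + d - arsinh (S x)) * S x - cosh d * cosh x)"
  have sd: "sinh d > 0"
    using d by simp
  have mono: "F e \<le> F x" if e: "0 < e" "e \<le> x" for e
  proof (rule DERIV_nonneg_imp_nondecreasing[OF e(2)])
    fix y assume "e \<le> y" "y \<le> x"
    then have y: "y > 0"
      using e by simp
    define D where "D = sinh d * (y * cosh y - sinh y) / y\<^sup>2"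
    have S': "(S has_real_derivative D) (at y)"
      unfolding S_def D_def using y
      by (auto intro!: derivative_eq_intros simp: field_simps power2_eq_square)
    have D: "D \<ge> 0"
      unfolding D_def using sinh_le_mult_cosh[of y] y sd by auto
    have q: "(S y)\<^sup>2 + 1 > 0"
      by (simp add: add_nonneg_pos)
    have F': "(F has_real_derivative
        D * (cosh d / sinh d * y\<^sup>2 / 2 + d - arsinh (S y))) (at y)"
    proof -
      define k where "k = cosh d / sinh d"
      have "(F has_real_derivative
         (2 * S y * D) / (2 * sqrt ((S y)\<^sup>2 + 1))
         + ((k * y - D / sqrt ((S y)\<^sup>2 + 1)) * S y
           + D * (k * y\<^sup>2 / 2 + d - arsinh (S y))) - cosh d * sinh y) (at y)"
        unfolding F_def k_def[symmetric] using q
        by (auto intro!: derivative_eq_intros S' DERIV_chain2[OF arsinh_real_has_field_derivative])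
          (simp add: divide_inverse mult_ac)
      moreover have "k * y * S y = cosh d * sinh y"
        using sd y by (simp add: S_def k_def)
      ultimately show ?thesis
        unfolding k_def[symmetric] by (simp add: algebra_simps)
    qed
    \<comment> \<open>Since \<open>D \<ge> 0\<close>, it remains to see that
      \<open>S y \<le> sinh (w + d)\<close>. This follows from
      \<open>sinh y / y \<le> cosh y \<le> exp w\<close>, where \<open>w \<ge> y\<^sup>2 / 2\<close>
      because \<open>cosh d / sinh d \<ge> 1\<close>.\<close>
    define w where "w = cosh d / sinh d * y\<^sup>2 / 2"
    have c: "cosh d / sinh d \<ge> 1"
      using sd sinh_le_cosh_real[of d] by simp
    then have w: "y\<^sup>2 / 2 \<le> w"
      unfolding w_def using mult_right_mono[OF c, of "y\<^sup>2 / 2"] by simp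
    moreover have "0 \<le> y\<^sup>2 / 2"
      by simp
    ultimately have "w \<ge> 0"
      by linarith
    have "sinh y / y \<le> cosh y"
      using sinh_le_mult_cosh[of y] y by (simp add: field_simps)
    also have "\<dots> \<le> exp w"
      using cosh_le_exp_half_square[of y] w by (meson exp_le_cancel_iff order_trans)
    finally have "S y \<le> sinh d * exp w"
      unfolding S_def using sd by (simp flip: times_divide_eq_right)
    also have "\<dots> = sinh d * cosh w + sinh d * sinh w"
      by (simp add: distrib_left flip: cosh_plus_sinh)
    also have "\<dots> \<le> sinh d * cosh w + cosh d * sinh w"
      using \<open>w \<ge> 0\<close> sinh_le_cosh_real[of d] by (intro add_left_mono mult_right_mono) auto
    also have "\<dots> = sinh (w + d)"
      by (simp add: sinh_add)
    finally have "arsinh (S y) \<le> w + d"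
      by (metis sinh_arsinh_real sinh_real_le_iff)
    then have "0 \<le> D * (cosh d / sinh d * y\<^sup>2 / 2 + d - arsinh (S y))"
      using D by (simp add: w_def)
    with F' show "\<exists>D. (F has_real_derivative D) (at y) \<and> 0 \<le> D"
      by blast
  qed
  \<comment> \<open>Division by zero makes \<open>S 0 = 0\<close> instead of \<open>sinh d\<close>,
    so the value of \<open>F\<close> at the left end has to be a limit from the right. The quotient
    \<open>sinh x / x\<close> is the difference quotient of \<open>sinh\<close> at 0.\<close>
  have "((\<lambda>x::real. sinh x / x) \<longlongrightarrow> 1) (at_right 0)"
  proof -
    have "(sinh has_real_derivative cosh 0) (at_right (0::real))"
      by (auto intro!: derivative_eq_intros)
    then show ?thesis
      by (simp add: has_field_derivative_iff)
  qed
  from tendsto_mult_left[OF this, of "sinh d"]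
  have S0: "(S \<longlongrightarrow> sinh d) (at_right 0)"
    unfolding S_def by simp
  have "(F \<longlongrightarrow> sqrt ((sinh d)\<^sup>2 + 1)
    + (cosh d / sinh d * 0\<^sup>2 / 2 + d - arsinh (sinh d)) * sinh d - cosh d * cosh 0) (at_right 0)"
    unfolding F_def using sd by (intro tendsto_intros S0) auto
  moreover have "sqrt ((sinh d)\<^sup>2 + 1) = cosh d"
    by (simp flip: cosh_square_eq)
  ultimately have "(F \<longlongrightarrow> 0) (at_right 0)"
    by (simp add: arsinh_sinh_real)
  moreover have "eventually (\<lambda>e. F e \<le> F x) (at_right 0)"
    using eventually_at_right_less[of 0] eventually_at_right_real[OF x]
    by eventually_elim (use mono in auto)
  ultimately have "0 \<le> F x"
    by (intro tendsto_upperbound) auto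
  then show ?thesis
    by (simp add: F_def)
qed

text \<open>The right-hand side is bounded below by the tangent of \<open>cosh\<close> at
  \<open>arsinh S\<close>, whose slope is \<open>S\<close>. The choice
  \<open>S * x = sinh d * sinh x\<close> makes the terms linear in \<open>u\<close> cancel, so one
  bound serves every \<open>u\<close>.\<close>

lemma cosh_quadratic_shift_ge:
  fixes d x u :: real
  assumes "0 < d" "0 < x"
  shows "cosh d * cosh x - u * sinh d * sinh x \<le> cosh (cosh d / sinh d * x\<^sup>2 / 2 + d - u * x)"
proof -
  define S where "S = sinh d * sinh x / x"
  define y where "y = cosh d / sinh d * x\<^sup>2 / 2 + d - u * x"
  have "cosh d * cosh x \<le> sqrt (S\<^sup>2 + 1) + (y + u * x - arsinh S) * S"
    using cosh_le_legendre[OF assms] by (simp add: S_def y_def)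
  moreover have "S * x = sinh d * sinh x"
    using assms by (simp add: S_def)
  then have "(y + u * x - arsinh S) * S = (y - arsinh S) * S + u * sinh d * sinh x"
    by (simp add: algebra_simps)
  ultimately have "cosh d * cosh x - u * sinh d * sinh x \<le> sqrt (S\<^sup>2 + 1) + (y - arsinh S) * S"
    by linarith
  also have "\<dots> \<le> cosh y"
    using cosh_ge_tangent[of "arsinh S" y] by (simp add: cosh_arsinh_real)
  finally show ?thesis
    by (simp add: y_def)
qed

text \<open>The resolvent inequality, cleared of denominators, for the mean-zero law with mass
  \<open>p\<close> at \<open>(1 - p) * s\<close> and \<open>1 - p\<close> at \<open>- p * s\<close>.
  Divided by \<open>k\<close>, it is \<open>cosh_quadratic_shift_ge\<close> at
  \<open>x = s / 2\<close>.\<close>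

lemma two_point_bound_pos:
  fixes l p s :: real
  assumes l: "0 < l" "l < 1" and s: "0 < s"
  defines "A \<equiv> exp ((1 - p) * s)" and "B \<equiv> exp (- p * s)" and "C \<equiv> exp (alpha l * s\<^sup>2 / 8)"
  shows "(p + l * (1 - p)) * A + (1 - p + l * p) * B \<le> C + l * A * B / C"
proof -
  \<comment> \<open>\<open>exp (- d)\<close> is the square root of \<open>l\<close>, which turns
    \<open>cosh d / sinh d\<close> into \<open>alpha l\<close>. The number \<open>u\<close> is the
    difference of the two weights, and \<open>k\<close> is the common factor of both sides.\<close>
  define d where "d = - ln l / 2"
  define r where "r = sqrt l"
  define u where "u = 1 - 2 * p"
  define k where "k = 2 * r * exp (u * s / 2)"
  have r: "r > 0" "r\<^sup>2 = l"
    using l by (auto simp: r_def)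
  have d: "d > 0" "exp d = 1 / r" "exp (- d) = r"
    using l r by (auto simp: d_def r_def ln_sqrt exp_minus field_simps simp flip: ln_sqrt)
  have ch: "2 * r * cosh d = 1 + l" "2 * r * sinh d = 1 - l"
    using d r by (auto simp: cosh_field_def sinh_field_def field_simps power2_eq_square)
  then have "cosh d / sinh d = alpha l"
    using r by (simp add: alpha_def flip: ch)
  with cosh_quadratic_shift_ge[of d "s / 2" u] d s
  have *: "cosh d * cosh (s / 2) - u * sinh d * sinh (s / 2)
      \<le> cosh (alpha l * s\<^sup>2 / 8 + d - u * s / 2)"
    by (simp add: power_divide)
  have "k * (cosh d * cosh (s / 2) - u * sinh d * sinh (s / 2))
    = exp (u * s / 2) * ((1 + l) * cosh (s / 2) - u * (1 - l) * sinh (s / 2))"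
    by (simp add: k_def algebra_simps flip: ch)
  also have "\<dots> = (p + l * (1 - p)) * (exp (u * s / 2) * exp (s / 2))
       + (1 - p + l * p) * (exp (u * s / 2) * exp (- (s / 2)))"
    by (simp add: cosh_field_def sinh_field_def u_def field_simps)
  also have "exp (u * s / 2) * exp (s / 2) = A"
    by (simp add: A_def u_def field_simps flip: exp_add)
  also have "exp (u * s / 2) * exp (- (s / 2)) = B"
    by (simp add: B_def u_def field_simps flip: exp_add)
  finally have L: "k * (cosh d * cosh (s / 2) - u * sinh d * sinh (s / 2))
     = (p + l * (1 - p)) * A + (1 - p + l * p) * B" .
  have AB: "exp (u * s / 2) * exp (u * s / 2) = A * B"
    by (simp add: A_def B_def u_def field_simps flip: exp_add)
  have e: "exp (alpha l * s\<^sup>2 / 8 + d - u * s / 2) = C / r / exp (u * s / 2)"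
    "exp (- (alpha l * s\<^sup>2 / 8 + d - u * s / 2)) = r * exp (u * s / 2) / C"
    using d(2) by (simp_all add: C_def exp_diff exp_add exp_minus)
  have "C > 0"
    by (simp add: C_def)
  have "k * cosh (alpha l * s\<^sup>2 / 8 + d - u * s / 2) = C + r\<^sup>2 * (exp (u * s / 2) * exp (u * s / 2)) / C"
    unfolding cosh_field_def e k_def using r \<open>C > 0\<close>
    by (simp add: field_simps power2_eq_square)
  also have "\<dots> = C + l * A * B / C"
    using r AB by simp
  finally have R: "k * cosh (alpha l * s\<^sup>2 / 8 + d - u * s / 2) = C + l * A * B / C" .
  have "k \<ge> 0"
    using r by (simp add: k_def)
  from mult_left_mono[OF * this] show ?thesis
    unfolding L R .
qed

lemma two_point_bound:
  fixes l p s :: real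
  assumes l: "0 \<le> l" "l < 1"
  defines "A \<equiv> exp ((1 - p) * s)" and "B \<equiv> exp (- p * s)" and "C \<equiv> exp (alpha l * s\<^sup>2 / 8)"
  shows "(p + l * (1 - p)) * A + (1 - p + l * p) * B \<le> C + l * A * B / C"
proof -
  define lhs rhs where "lhs = (\<lambda>l. (p + l * (1 - p)) * A + (1 - p + l * p) * B)"
    and "rhs = (\<lambda>l. exp (alpha l * s\<^sup>2 / 8) + l * A * B / exp (alpha l * s\<^sup>2 / 8))"
  \<comment> \<open>Negative \<open>s\<close> is handled by exchanging the two atoms,
    \<open>s\<close> to \<open>- s\<close> and \<open>p\<close> to \<open>1 - p\<close>. At
    \<open>s = 0\<close> both sides equal \<open>1 + l\<close>.\<close>
  have pos: "lhs l \<le> rhs l" if "0 < l" "l < 1" for l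
    unfolding lhs_def rhs_def A_def B_def
    using two_point_bound_pos[OF that, of s p] two_point_bound_pos[OF that, of "- s" "1 - p"]
    by (cases s "0 :: real" rule: linorder_cases) (auto simp: algebra_simps)
  have "lhs l \<le> rhs l"
  proof (cases "l = 0")
    case False
    then show ?thesis
      using pos l by auto
  next
    \<comment> \<open>The substitution through \<open>ln l\<close> breaks down at
      \<open>l = 0\<close>, so the bound is carried there by a limit.\<close>
    case True
    have "(lhs \<longlongrightarrow> lhs 0) (at_right 0)" "(rhs \<longlongrightarrow> rhs 0) (at_right 0)"
      unfolding lhs_def rhs_def alpha_def by (auto intro!: tendsto_eq_intros)
    moreover have "eventually (\<lambda>l. lhs l \<le> rhs l) (at_right 0)"
      by (rule eventually_mono[OF eventually_at_right_real[of 0 1]]) (auto intro: pos)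
    ultimately show ?thesis
      unfolding True by (intro tendsto_le[of "at_right (0::real)"]) auto
  qed
  then show ?thesis
    by (simp add: lhs_def rhs_def C_def)
qed

text \<open>The logarithmic mean of \<open>l\<close> and 1 lies below their arithmetic mean.\<close>

lemma log_mean_bound:
  fixes l :: real
  assumes "0 < l" "l < 1"
  shows "2 * (1 - l) / (1 + l) < - ln l"
proof -
  have "(\<lambda>l. ln l + 2 * (1 - l) / (1 + l)) l < (\<lambda>l. ln l + 2 * (1 - l) / (1 + l)) 1"
  proof (rule DERIV_pos_imp_increasing_open[OF assms(2)])
    fix y :: real assume "l < y" "y < 1"
    with assms have y: "0 < y" "y < 1" by auto
    have "((\<lambda>l. ln l + 2 * (1 - l) / (1 + l)) has_real_derivative
        1 / y + (- 2 * (1 + y) - 2 * (1 - y)) / ((1 + y) * (1 + y))) (at y)"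
      using y by (auto intro!: derivative_eq_intros)
    also have "1 / y + (- 2 * (1 + y) - 2 * (1 - y)) / ((1 + y) * (1 + y))
        = (1 - y)\<^sup>2 / (y * (1 + y)\<^sup>2)"
      using y by (simp add: divide_simps power2_eq_square) (simp add: algebra_simps)
    finally have "((\<lambda>l. ln l + 2 * (1 - l) / (1 + l)) has_real_derivative
        (1 - y)\<^sup>2 / (y * (1 + y)\<^sup>2)) (at y)" .
    moreover have "(1 - y)\<^sup>2 / (y * (1 + y)\<^sup>2) > 0"
      using y by simp
    ultimately show "\<exists>D. ((\<lambda>l. ln l + 2 * (1 - l) / (1 + l)) has_real_derivative D) (at y) \<and> 0 < D"
      by blast
  qed (use assms in \<open>auto intro!: continuous_intros\<close>)
  then show ?thesis
    by simp
qed

text \<open>Keeps the denominators of the resolvent positive. After taking logarithms, completing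
  the square gives \<open>k * s\<^sup>2 / 8 - s \<ge> - 2 / k\<close>, and
  \<open>2 / k < - ln l\<close> is \<open>log_mean_bound\<close>.\<close>

lemma mult_exp_less_exp_alpha:
  fixes l s :: real
  assumes "0 \<le> l" "l < 1"
  shows "l * exp s < exp (alpha l * s\<^sup>2 / 8)"
proof (cases "l = 0")
  case False
  then have l: "0 < l" using assms by simp
  define k where "k = alpha l"
  have k: "k > 0" "2 / k = 2 * (1 - l) / (1 + l)"
    using assms by (auto simp: k_def alpha_def)
  have "0 \<le> (k * s - 4)\<^sup>2 / (8 * k)"
    using k by simp
  also have "\<dots> = k * s\<^sup>2 / 8 - s + 2 / k"
    using k by (simp add: power2_eq_square field_simps)
  finally have "ln l + s < k * s\<^sup>2 / 8"
    using log_mean_bound[OF l assms(2)] k by linarith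
  then have "exp (ln l + s) < exp (k * s\<^sup>2 / 8)"
    by simp
  then show ?thesis
    using l by (simp add: exp_add k_def)
qed auto

section \<open>The Leon-Perron quadratic form\<close>

text \<open>The bound holds at every point of the space, not almost everywhere, so that it passes
  from \<open>B\<close> to every \<open>P x\<close>, also for \<open>x\<close> in a null set of
  \<pi>.\<close>

definition bounded_borel :: "'a measure \<Rightarrow> ('a \<Rightarrow> real) set" where
  "bounded_borel M = {f \<in> borel_measurable M. \<exists>K. \<forall>x\<in>space M. \<bar>f x\<bar> \<le> K}"

lemma bounded_borelI:
  assumes "f \<in> borel_measurable M" "\<And>x. x \<in> space M \<Longrightarrow> \<bar>f x\<bar> \<le> K"
  shows "f \<in> bounded_borel M"
  using assms by (auto simp: bounded_borel_def)

lemma bounded_borelE: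
  assumes "f \<in> bounded_borel M"
  obtains K where "0 \<le> K" "\<And>x. x \<in> space M \<Longrightarrow> \<bar>f x\<bar> \<le> K"
proof -
  from assms obtain K where K: "\<And>x. x \<in> space M \<Longrightarrow> \<bar>f x\<bar> \<le> K"
    by (auto simp: bounded_borel_def)
  then have "\<bar>f x\<bar> \<le> max K 0" if "x \<in> space M" for x
    using that by (simp add: max.coboundedI1)
  with that[of "max K 0"] show thesis
    by simp
qed

lemma bounded_borel_measurable: "f \<in> bounded_borel M \<Longrightarrow> f \<in> borel_measurable M"
  by (simp add: bounded_borel_def)

lemma bounded_borel_const [simp, intro]: "(\<lambda>_. c) \<in> bounded_borel M"
  by (rule bounded_borelI[of _ _ "\<bar>c\<bar>"]) auto

lemma bounded_borel_add [intro]: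
  assumes "f \<in> bounded_borel M" "g \<in> bounded_borel M"
  shows "(\<lambda>x. f x + g x) \<in> bounded_borel M"
proof -
  obtain K where K: "\<And>x. x \<in> space M \<Longrightarrow> \<bar>f x\<bar> \<le> K"
    using bounded_borelE[OF assms(1)] by blast
  obtain L where L: "\<And>x. x \<in> space M \<Longrightarrow> \<bar>g x\<bar> \<le> L"
    using bounded_borelE[OF assms(2)] by blast
  show ?thesis
  proof (rule bounded_borelI)
    show "\<bar>f x + g x\<bar> \<le> K + L" if "x \<in> space M" for x
      using K[OF that] L[OF that] by linarith
  qed (use assms[THEN bounded_borel_measurable] in auto)
qed

lemma bounded_borel_mult [intro]:
  assumes "f \<in> bounded_borel M" "g \<in> bounded_borel M"
  shows "(\<lambda>x. f x * g x) \<in> bounded_borel M"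
proof -
  obtain K where "0 \<le> K" and K: "\<And>x. x \<in> space M \<Longrightarrow> \<bar>f x\<bar> \<le> K"
    using bounded_borelE[OF assms(1)] by blast
  obtain L where L: "\<And>x. x \<in> space M \<Longrightarrow> \<bar>g x\<bar> \<le> L"
    using bounded_borelE[OF assms(2)] by blast
  show ?thesis
  proof (rule bounded_borelI)
    show "\<bar>f x * g x\<bar> \<le> K * L" if "x \<in> space M" for x
      using K[OF that] L[OF that] \<open>0 \<le> K\<close> by (auto simp: abs_mult intro!: mult_mono)
  qed (use assms[THEN bounded_borel_measurable] in auto)
qed

lemma bounded_borel_diff [intro]:
  assumes "f \<in> bounded_borel M" "g \<in> bounded_borel M"
  shows "(\<lambda>x. f x - g x) \<in> bounded_borel M"
  using bounded_borel_add[OF assms(1) bounded_borel_mult[OF bounded_borel_const[of "-1"] assms(2)]]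
  by simp

lemma bounded_borel_power [intro]:
  "f \<in> bounded_borel M \<Longrightarrow> (\<lambda>x. f x ^ n) \<in> bounded_borel M"
  by (induction n) auto

lemma bounded_borel_exp [intro]:
  assumes "f \<in> bounded_borel M"
  shows "(\<lambda>x. exp (f x)) \<in> bounded_borel M"
proof -
  obtain K where K: "\<And>x. x \<in> space M \<Longrightarrow> \<bar>f x\<bar> \<le> K"
    using bounded_borelE[OF assms] by blast
  show ?thesis
  proof (rule bounded_borelI)
    show "\<bar>exp (f x)\<bar> \<le> exp K" if "x \<in> space M" for x
      using K[OF that] by simp
  qed (use assms[THEN bounded_borel_measurable] in auto)
qed

lemma bounded_borel_inverse:
  assumes "f \<in> bounded_borel M" "0 < e" "\<And>x. x \<in> space M \<Longrightarrow> e \<le> f x"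
  shows "(\<lambda>x. inverse (f x)) \<in> bounded_borel M"
proof (rule bounded_borelI)
  show "\<bar>inverse (f x)\<bar> \<le> inverse e" if "x \<in> space M" for x
    using assms(2) assms(3)[OF that] by (simp add: le_imp_inverse_le)
qed (use assms(1)[THEN bounded_borel_measurable] in auto)

lemma (in finite_measure) integrable_bounded_borel [intro]:
  assumes "f \<in> bounded_borel M"
  shows "integrable M f"
proof -
  obtain K where "\<And>x. x \<in> space M \<Longrightarrow> \<bar>f x\<bar> \<le> K"
    using bounded_borelE[OF assms] by blast
  then show ?thesis
    using assms[THEN bounded_borel_measurable]
    by (intro integrable_const_bound[of _ K]) auto
qed

lemma (in finite_measure) Cauchy_Schwarz_bounded_borel:
  assumes "f \<in> bounded_borel M" "g \<in> bounded_borel M"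
  shows "(\<integral>x. f x * g x \<partial>M)\<^sup>2 \<le> (\<integral>x. (f x)\<^sup>2 \<partial>M) * (\<integral>x. (g x)\<^sup>2 \<partial>M)"
proof -
  define F G H where "F = (\<integral>x. (f x)\<^sup>2 \<partial>M)" and "G = (\<integral>x. (g x)\<^sup>2 \<partial>M)" and "H = (\<integral>x. f x * g x \<partial>M)"
  have int: "integrable M (\<lambda>x. (f x)\<^sup>2)" "integrable M (\<lambda>x. (g x)\<^sup>2)" "integrable M (\<lambda>x. f x * g x)"
    using assms by auto
  \<comment> \<open>A nonnegative quadratic in \<open>c\<close>; its minimizer \<open>H / G\<close>
    gives the claim. If \<open>G = 0\<close> it is linear, and for \<open>H \<noteq> 0\<close> it
    would take the value -1 at \<open>c = (F + 1) / (2 * H)\<close>.\<close>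
  have quad: "0 \<le> F - 2 * c * H + c\<^sup>2 * G" for c
  proof -
    have "0 \<le> (\<integral>x. (f x - c * g x)\<^sup>2 \<partial>M)"
      by (rule integral_nonneg_AE) auto
    also have "\<dots> = (\<integral>x. (f x)\<^sup>2 - 2 * c * (f x * g x) + c\<^sup>2 * (g x)\<^sup>2 \<partial>M)"
      by (simp add: power2_diff power_mult_distrib algebra_simps)
    also have "\<dots> = F - 2 * c * H + c\<^sup>2 * G"
      using int by (simp add: F_def G_def H_def)
    finally show ?thesis .
  qed
  have "G \<ge> 0"
    unfolding G_def by (rule integral_nonneg_AE) auto
  show ?thesis
  proof (cases "G = 0")
    case True
    have "H = 0"
    proof (rule ccontr)
      assume "H \<noteq> 0"
      then show False
        using quad[of "(F + 1) / (2 * H)"] True by simp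
    qed
    then show ?thesis
      using True by (simp add: G_def H_def)
  next
    case False
    then have "0 \<le> F - H\<^sup>2 / G"
      using quad[of "H / G"] by (simp add: power2_eq_square)
    then have "H\<^sup>2 \<le> F * G"
      using False \<open>G \<ge> 0\<close> by (simp add: pos_divide_le_eq)
    then show ?thesis
      by (simp add: F_def G_def H_def)
  qed
qed

section \<open>Resolvent bound for mean-zero functions with values in an interval\<close>

lemma fraction_convex_bound:
  fixes l C A B \<theta> z :: real
  assumes l: "0 \<le> l" and A: "l * A < C" and B: "l * B < C" and C: "0 < C" and \<theta>: "0 \<le> \<theta>" "\<theta> \<le> 1"
    and z: "0 \<le> z" "z \<le> \<theta> * A + (1 - \<theta>) * B"
  shows "z / (C - l * z) \<le> \<theta> * (A / (C - l * A)) + (1 - \<theta>) * (B / (C - l * B))"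
proof -
  define \<alpha> \<beta> y where "\<alpha> = C - l * A" and "\<beta> = C - l * B" and "y = \<theta> * A + (1 - \<theta>) * B"
  have pos: "\<alpha> > 0" "\<beta> > 0"
    using A B by (auto simp: \<alpha>_def \<beta>_def)
  have y: "C - l * y = \<theta> * \<alpha> + (1 - \<theta>) * \<beta>"
    by (simp add: y_def \<alpha>_def \<beta>_def algebra_simps)
  also have "\<dots> > 0"
    using pos \<theta> by (cases "\<theta> = 0") (auto intro: add_pos_nonneg)
  finally have ypos: "C - l * y > 0" .
  \<comment> \<open>The fraction increases in \<open>z\<close>, so only the point \<open>y\<close>
    on the chord matters, and there the claim is convexity.\<close>
  have "l * z \<le> l * y"
    using z l by (auto simp: y_def intro: mult_left_mono)
  then have "z / (C - l * z) \<le> y / (C - l * y)"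
    using z ypos by (intro frac_le) (auto simp: y_def)
  also have "y / (C - l * y) \<le> \<theta> * (A / \<alpha>) + (1 - \<theta>) * (B / \<beta>)"
  proof -
    \<comment> \<open>Multiplied by the positive denominator, the gap between chord and function is
      a nonnegative multiple of \<open>(A - B)\<^sup>2\<close>.\<close>
    have "(\<theta> * (A / \<alpha>) + (1 - \<theta>) * (B / \<beta>)) * (\<theta> * \<alpha> + (1 - \<theta>) * \<beta>) - y
        = \<theta> * (1 - \<theta>) * (A / \<alpha> - B / \<beta>) * (\<beta> - \<alpha>)"
      using pos by (simp add: y_def field_simps)
    also have "A / \<alpha> - B / \<beta> = C * (A - B) / (\<alpha> * \<beta>)"
      using pos by (simp add: diff_frac_eq) (simp add: \<alpha>_def \<beta>_def algebra_simps)
    also have "\<theta> * (1 - \<theta>) * (C * (A - B) / (\<alpha> * \<beta>)) * (\<beta> - \<alpha>)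
        = \<theta> * (1 - \<theta>) * (C * l * (A - B)\<^sup>2 / (\<alpha> * \<beta>))"
      by (simp add: \<alpha>_def \<beta>_def power2_eq_square algebra_simps)
    also have "\<dots> \<ge> 0"
      using pos C l \<theta> by auto
    finally show ?thesis
      using ypos by (simp add: y pos_divide_le_eq)
  qed
  finally show ?thesis
    by (simp add: \<alpha>_def \<beta>_def)
qed

text \<open>\<open>two_point_bound\<close> multiplied by \<open>C\<close>, rearranged, and divided
  by the positive product \<open>(C - l * A) * (C - l * B)\<close>.\<close>

lemma two_point_resolvent_bound:
  fixes l p s C A B :: real
  assumes l: "0 \<le> l" "l < 1"
    and "A = exp ((1 - p) * s)" "B = exp (- p * s)" "C = exp (alpha l * s\<^sup>2 / 8)"
    and A: "l * A < C" and B: "l * B < C"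
  shows "(1 - l) * (p * (A / (C - l * A)) + (1 - p) * (B / (C - l * B))) \<le> 1"
proof -
  have C: "C > 0"
    using assms by simp
  have "(p + l * (1 - p)) * A + (1 - p + l * p) * B \<le> C + l * A * B / C"
    using two_point_bound[OF l, of p s] assms by simp
  then have "((p + l * (1 - p)) * A + (1 - p + l * p) * B) * C \<le> (C + l * A * B / C) * C"
    using C by (intro mult_right_mono) auto
  also have "\<dots> = C * C + l * A * B"
    using C by (simp add: field_simps)
  finally have "(1 - l) * (p * A * (C - l * B) + (1 - p) * B * (C - l * A)) \<le> (C - l * A) * (C - l * B)"
    by (simp add: algebra_simps)
  moreover have "p * (A / (C - l * A)) + (1 - p) * (B / (C - l * B))
    = (p * A * (C - l * B) + (1 - p) * B * (C - l * A)) / ((C - l * A) * (C - l * B))"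
    using A B by (simp add: add_frac_eq)
  ultimately show ?thesis
    using A B by (simp add: pos_divide_le_eq)
qed

lemma mult_exp_less_exp_alpha_range:
  fixes l x t d :: real
  assumes "0 \<le> l" "l < 1" "\<bar>x\<bar> \<le> d"
  shows "l * exp (t * x) < exp (alpha l * (t * d)\<^sup>2 / 8)"
proof -
  have "t * x \<le> \<bar>t\<bar> * d"
    using mult_left_mono[OF assms(3), of "\<bar>t\<bar>"] abs_ge_self[of "t * x"] by (simp add: abs_mult)
  then have "l * exp (t * x) \<le> l * exp (\<bar>t\<bar> * d)"
    using assms by (intro mult_left_mono) auto
  then show "l * exp (t * x) < exp (alpha l * (t * d)\<^sup>2 / 8)"
    using mult_exp_less_exp_alpha[of l "\<bar>t\<bar> * d"] assms by (simp add: power_mult_distrib)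
qed

text \<open>With \<open>z = exp (t * f x)\<close> the inverse is \<open>z / (C - l * z)\<close>, an
  increasing convex function of a convex one, hence below its chord over \<open>{a..b}\<close>. The
  mean of the chord depends on \<open>f\<close> only through its mean 0, so it is the value for the
  mean-zero law on the two endpoints.\<close>

lemma (in prob_space) mean_zero_resolvent_bound:
  fixes f :: "'a \<Rightarrow> real" and a b t l C :: real
  assumes l: "0 \<le> l" "l < 1" and f: "f \<in> borel_measurable M"
    and ab: "\<And>x. x \<in> space M \<Longrightarrow> f x \<in> {a..b}" and f0: "expectation f = 0"
    and C: "C = exp (alpha l * (t * (b - a))\<^sup>2 / 8)"
  shows "\<And>x. x \<in> space M \<Longrightarrow> C * exp (- (t * f x)) - l > 0"
    and "(\<lambda>x. inverse (C * exp (- (t * f x)) - l)) \<in> bounded_borel M"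
    and "(1 - l) * expectation (\<lambda>x. inverse (C * exp (- (t * f x)) - l)) \<le> 1"
proof -
  have fb: "f \<in> bounded_borel M"
    using ab by (intro bounded_borelI[OF f, of "\<bar>a\<bar> + \<bar>b\<bar>"]) force
  have a: "a \<le> 0"
    using integral_ge_const[of f a] fb ab f0 by (auto intro!: integrable_bounded_borel)
  have b: "0 \<le> b"
    using integral_le_const[of f b] fb ab f0 by (auto intro!: integrable_bounded_borel)
  have fd: "\<bar>f x\<bar> \<le> b - a" if "x \<in> space M" for x
    using ab[OF that] a b by auto
  have Cpos: "C > 0"
    by (simp add: C)
  have lt: "l * exp (t * x) < C" if "\<bar>x\<bar> \<le> b - a" for x
    using mult_exp_less_exp_alpha_range[OF l that] by (simp add: C)
  have eq: "inverse (C * exp (- (t * x)) - l) = exp (t * x) / (C - l * exp (t * x))" for x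
  proof -
    have "C * exp (- (t * x)) - l = (C - l * exp (t * x)) / exp (t * x)"
      by (simp add: field_simps exp_minus)
    then show ?thesis
      by simp
  qed
  \<comment> \<open>A lower bound uniform in \<open>x\<close>, which makes the inverse
    bounded.\<close>
  define e where "e = C * exp (- (\<bar>t\<bar> * (b - a))) - l"
  have e: "e > 0"
  proof -
    define s where "s = \<bar>t\<bar> * (b - a)"
    have "l * exp s < C"
      using mult_exp_less_exp_alpha[OF l, of s] by (simp add: C s_def power_mult_distrib)
    then show ?thesis
      unfolding e_def s_def[symmetric] by (simp add: exp_minus field_simps)
  qed
  have bound: "e \<le> C * exp (- (t * f x)) - l" if "x \<in> space M" for x
  proof -
    have "- t * f x \<ge> - (\<bar>t\<bar> * (b - a))"
      using mult_left_mono[OF fd[OF that], of "\<bar>t\<bar>"] abs_ge_self[of "t * f x"] by (simp add: abs_mult)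
    then show ?thesis
      using Cpos by (simp add: e_def)
  qed
  show "C * exp (- (t * f x)) - l > 0" if "x \<in> space M" for x
    using bound[OF that] e by simp
  show inv: "(\<lambda>x. inverse (C * exp (- (t * f x)) - l)) \<in> bounded_borel M"
  proof (rule bounded_borel_inverse[OF _ e bound])
    have "(\<lambda>x. C * exp ((- t) * f x) - l) \<in> bounded_borel M"
      by (intro bounded_borel_diff bounded_borel_exp bounded_borel_mult bounded_borel_const fb)
    then show "(\<lambda>x. C * exp (- (t * f x)) - l) \<in> bounded_borel M"
      by simp
  qed
  show "(1 - l) * expectation (\<lambda>x. inverse (C * exp (- (t * f x)) - l)) \<le> 1"
  proof (cases "a = b")
    \<comment> \<open>The chord degenerates here, but \<open>f\<close> vanishes and
      \<open>C = 1\<close>, so the bound is an equality.\<close>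
    case True
    then have "f x = 0" if "x \<in> space M" for x
      using fd[OF that] by simp
    then have "expectation (\<lambda>x. inverse (C * exp (- (t * f x)) - l)) = expectation (\<lambda>x. inverse (1 - l))"
      using True by (intro Bochner_Integration.integral_cong) (auto simp: C)
    then show ?thesis
      using l by (simp add: prob_space)
  next
    case False
    with a b have "a < b" by simp
    define \<theta> where "\<theta> = (\<lambda>x. (f x - a) / (b - a))"
    \<comment> \<open>\<open>p\<close> is the weight at \<open>b\<close> for which the law on
      \<open>a\<close> and \<open>b\<close> has mean 0.\<close>
    define A B p where "A = exp (t * b)" and "B = exp (t * a)" and "p = - a / (b - a)"
    have A: "l * A < C" and B: "l * B < C"
      using lt[of b] lt[of a] a b by (auto simp: A_def B_def)
    have \<theta>: "0 \<le> \<theta> x" "\<theta> x \<le> 1" if "x \<in> space M" for x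
      using ab[OF that] \<open>a < b\<close> by (auto simp: \<theta>_def)
    have \<theta>b: "\<theta> \<in> bounded_borel M"
      unfolding \<theta>_def divide_inverse by (intro bounded_borel_mult bounded_borel_diff bounded_borel_const fb)
    have pw: "inverse (C * exp (- (t * f x)) - l)
        \<le> \<theta> x * (A / (C - l * A)) + (1 - \<theta> x) * (B / (C - l * B))" if x: "x \<in> space M" for x
    proof -
      have "exp ((1 - \<theta> x) *\<^sub>R (t * a) + \<theta> x *\<^sub>R (t * b)) \<le> (1 - \<theta> x) * exp (t * a) + \<theta> x * exp (t * b)"
        using \<theta>[OF x] convex_onD[OF convex_on_exp[of 1], of "\<theta> x" "t * a" "t * b"] by simp
      moreover have "(1 - \<theta> x) *\<^sub>R (t * a) + \<theta> x *\<^sub>R (t * b) = t * f x"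
      proof -
        have "\<theta> x * (b - a) = f x - a"
          using \<open>a < b\<close> by (simp add: \<theta>_def)
        moreover have "(1 - \<theta> x) *\<^sub>R (t * a) + \<theta> x *\<^sub>R (t * b) = t * (a + \<theta> x * (b - a))"
          by (simp add: algebra_simps)
        ultimately show ?thesis
          by simp
      qed
      ultimately have "exp (t * f x) \<le> \<theta> x * A + (1 - \<theta> x) * B"
        by (simp add: A_def B_def)
      then show ?thesis
        unfolding eq using \<theta>[OF x] by (intro fraction_convex_bound l A B Cpos) auto
    qed
    from inv have "expectation (\<lambda>x. inverse (C * exp (- (t * f x)) - l))
       \<le> expectation (\<lambda>x. \<theta> x * (A / (C - l * A)) + (1 - \<theta> x) * (B / (C - l * B)))"
      by (intro integral_mono pw integrable_bounded_borel bounded_borel_add bounded_borel_mult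
          bounded_borel_diff bounded_borel_const \<theta>b)
    also have "\<dots> = expectation \<theta> * (A / (C - l * A)) + (1 - expectation \<theta>) * (B / (C - l * B))"
      using \<theta>b by (simp add: integrable_bounded_borel prob_space)
    also have "expectation \<theta> = p"
      unfolding \<theta>_def p_def using fb f0 by (simp add: integrable_bounded_borel prob_space)
    finally have "(1 - l) * expectation (\<lambda>x. inverse (C * exp (- (t * f x)) - l))
        \<le> (1 - l) * (p * (A / (C - l * A)) + (1 - p) * (B / (C - l * B)))"
      using l by (intro mult_left_mono) auto
    also have "\<dots> \<le> 1"
    proof (rule two_point_resolvent_bound[OF l _ _ C A B])
      show "A = exp ((1 - p) * (t * (b - a)))" "B = exp (- p * (t * (b - a)))"
        using \<open>a < b\<close> by (auto simp: A_def B_def p_def field_simps)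
    qed
    finally show ?thesis .
  qed
qed

lemma (in prob_space) leon_perron_quadratic_form_bound:
  fixes f v :: "'a \<Rightarrow> real" and a b t l C :: real
  assumes l: "0 \<le> l" "l < 1" and f: "f \<in> borel_measurable M"
    and ab: "\<And>x. x \<in> space M \<Longrightarrow> f x \<in> {a..b}" and f0: "expectation f = 0"
    and C: "C = exp (alpha l * (t * (b - a))\<^sup>2 / 8)"
    and v: "v \<in> bounded_borel M"
  shows "l * expectation (\<lambda>x. (v x)\<^sup>2) + (1 - l) * (expectation v)\<^sup>2
    \<le> C * expectation (\<lambda>x. (v x)\<^sup>2 * exp (- (t * f x)))"
proof -
  define w wi c where "w = (\<lambda>x. C * exp (- (t * f x)) - l)" and "wi = (\<lambda>x. inverse (w x))"
    and "c = (1 - l) * expectation v"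
  note resolvent = mean_zero_resolvent_bound[OF l f ab f0 C]
  have wpos: "w x > 0" if "x \<in> space M" for x
    using resolvent(1)[of x] that by (simp add: w_def)
  have wi: "wi \<in> bounded_borel M" "(1 - l) * expectation wi \<le> 1"
    using resolvent(2,3) by (simp_all add: wi_def w_def)
  have fb: "f \<in> bounded_borel M"
    using ab by (intro bounded_borelI[OF f, of "\<bar>a\<bar> + \<bar>b\<bar>"]) force
  then have "(\<lambda>x. exp ((- t) * f x)) \<in> bounded_borel M"
    by (intro bounded_borel_exp bounded_borel_mult bounded_borel_const)
  then have e: "(\<lambda>x. exp (- (t * f x))) \<in> bounded_borel M"
    by simp
  have int: "integrable M (\<lambda>x. (v x)\<^sup>2)" "integrable M v" "integrable M wi"
      "integrable M (\<lambda>x. (v x)\<^sup>2 * exp (- (t * f x)))"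
    using v wi integrable_bounded_borel[OF bounded_borel_mult[OF bounded_borel_power[OF v] e]] by auto
  \<comment> \<open>Cauchy-Schwarz with weight \<open>w\<close>, as a completed square. By the
    choice of \<open>c\<close> and the bound on the mean of \<open>wi\<close>, the terms in
    \<open>c\<close> and \<open>c\<^sup>2\<close> together are at most
    \<open>- (1 - l) * (expectation v)\<^sup>2\<close>.\<close>
  have "0 \<le> expectation (\<lambda>x. w x * (v x - c * wi x)\<^sup>2)"
    using wpos by (intro integral_nonneg_AE AE_I2) (simp add: less_imp_le)
  also have "\<dots> = expectation (\<lambda>x. C * ((v x)\<^sup>2 * exp (- (t * f x))) - l * (v x)\<^sup>2 - 2 * c * v x + c\<^sup>2 * wi x)"
  proof (intro Bochner_Integration.integral_cong refl)
    fix x assume "x \<in> space M"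
    then have "w x * wi x = 1"
      using wpos[of x] by (simp add: wi_def)
    then have "w x * (v x - c * wi x)\<^sup>2 = w x * (v x)\<^sup>2 - 2 * c * v x + c\<^sup>2 * wi x"
      by algebra
    then show "w x * (v x - c * wi x)\<^sup>2
        = C * ((v x)\<^sup>2 * exp (- (t * f x))) - l * (v x)\<^sup>2 - 2 * c * v x + c\<^sup>2 * wi x"
      by (simp add: w_def algebra_simps)
  qed
  also have "\<dots> = C * expectation (\<lambda>x. (v x)\<^sup>2 * exp (- (t * f x))) - l * expectation (\<lambda>x. (v x)\<^sup>2)
      - 2 * c * expectation v + c\<^sup>2 * expectation wi"
    using int by simp
  also have "c\<^sup>2 * expectation wi = (1 - l) * (expectation v)\<^sup>2 * ((1 - l) * expectation wi)"
    by (simp add: c_def power2_eq_square)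
  also have "\<dots> \<le> (1 - l) * (expectation v)\<^sup>2 * 1"
    using wi(2) l by (intro mult_left_mono) auto
  finally show ?thesis
    by (simp add: c_def power2_eq_square algebra_simps)
qed

section \<open>Kernels with an invariant measure\<close>

locale stationary_kernel =
  fixes B \<pi> :: "'a measure" and P :: "'a \<Rightarrow> 'a measure"
  assumes kernel: "transition_kernel B P" and invariant: "invariant_prob_measure B P \<pi>"
begin

sublocale prob_space \<pi>
  using invariant by (simp add: invariant_prob_measure_def)

lemma sets_eq [measurable_cong, simp]: "sets \<pi> = sets B"
  using invariant by (simp add: invariant_prob_measure_def)

lemma space_eq [simp]: "space \<pi> = space B"
  by (rule sets_eq_imp_space_eq) simp

lemma prob_space_B [simp]: "prob (space B) = 1"
  using prob_space by simp

lemma kernel_subprob [measurable]: "P \<in> measurable B (subprob_algebra B)"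
  using kernel unfolding transition_kernel_def by (rule measurable_prob_algebraD)

lemma prob_space_kernel: "x \<in> space B \<Longrightarrow> prob_space (P x)"
  using measurable_space[OF kernel[unfolded transition_kernel_def]] by (simp add: space_prob_algebra)

lemma sets_kernel_eq: "x \<in> space B \<Longrightarrow> sets (P x) = sets B"
  by (rule sets_kernel[OF kernel_subprob])

lemma space_kernel_eq: "x \<in> space B \<Longrightarrow> space (P x) = space B"
  by (rule sets_eq_imp_space_eq[OF sets_kernel_eq])

lemma bounded_borel_eq: "bounded_borel \<pi> = bounded_borel B"
  by (simp add: bounded_borel_def cong: measurable_cong_sets)

lemma integrable_kernel:
  assumes "x \<in> space B" "h \<in> bounded_borel B"
  shows "integrable (P x) h"
proof -
  interpret Px: prob_space "P x"
    by (rule prob_space_kernel[OF assms(1)])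
  have "h \<in> bounded_borel (P x)"
    using assms(2) sets_kernel_eq[OF assms(1)] space_kernel_eq[OF assms(1)]
    by (simp add: bounded_borel_def cong: measurable_cong_sets)
  then show ?thesis ..
qed

text \<open>Invariance in monadic form, so that the integration rules for \<open>\<bind>\<close>
  carry it from sets to functions.\<close>

lemma bind_kernel: "\<pi> \<bind> P = \<pi>"
proof (rule measure_eqI)
  have [measurable]: "P \<in> measurable \<pi> (subprob_algebra B)"
    by measurable
  show s: "sets (\<pi> \<bind> P) = sets \<pi>"
    using not_empty by (subst sets_bind[where N = B]) (auto simp: sets_kernel_eq)
  fix A assume "A \<in> sets (\<pi> \<bind> P)"
  then show "emeasure (\<pi> \<bind> P) A = emeasure \<pi> A"
    using s invariant not_empty by (subst emeasure_bind[of _ _ B]) (auto simp: invariant_prob_measure_def)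
qed

lemma nn_integral_kernel:
  assumes "u \<in> borel_measurable B"
  shows "(\<integral>\<^sup>+x. \<integral>\<^sup>+y. u y \<partial>P x \<partial>\<pi>) = (\<integral>\<^sup>+x. u x \<partial>\<pi>)"
  using nn_integral_bind[OF assms, of P \<pi>] by (simp add: bind_kernel)

lemma bounded_borel_markov_operator:
  assumes "h \<in> bounded_borel B"
  shows "markov_operator P h \<in> bounded_borel B"
proof -
  obtain K where K: "\<And>x. x \<in> space B \<Longrightarrow> \<bar>h x\<bar> \<le> K"
    using bounded_borelE[OF assms] by blast
  have [measurable]: "h \<in> borel_measurable B"
    using assms by (rule bounded_borel_measurable)
  show ?thesis
  proof (rule bounded_borelI)
    show "markov_operator P h \<in> borel_measurable B"
      unfolding markov_operator_def by measurable
    fix x assume x: "x \<in> space B"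
    interpret Px: prob_space "P x"
      by (rule prob_space_kernel[OF x])
    have "\<bar>markov_operator P h x\<bar> \<le> (\<integral>y. \<bar>h y\<bar> \<partial>P x)"
      unfolding markov_operator_def by (rule integral_abs_bound)
    also have "\<dots> \<le> K"
      using integrable_kernel[OF x assms] K space_kernel_eq[OF x]
      by (intro Px.integral_le_const) auto
    finally show "\<bar>markov_operator P h x\<bar> \<le> K" .
  qed
qed

lemma integral_markov_operator:
  assumes "h \<in> bounded_borel B"
  shows "(\<integral>x. markov_operator P h x \<partial>\<pi>) = (\<integral>x. h x \<partial>\<pi>)"
proof -
  obtain K where K: "\<And>x. x \<in> space B \<Longrightarrow> \<bar>h x\<bar> \<le> K"
    using bounded_borelE[OF assms] by blast
  have "(\<integral>x. h x \<partial>(\<pi> \<bind> P)) = (\<integral>x. markov_operator P h x \<partial>\<pi>)"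
    unfolding markov_operator_def
    by (rule integral_bind[where K = B and B = K and B' = 1])
       (use K assms prob_space_kernel in \<open>auto simp: bounded_borel_measurable prob_space.emeasure_space_1
          intro: finite_measure_axioms\<close>)
  then show ?thesis
    by (simp add: bind_kernel)
qed

text \<open>Jensen's inequality, from the nonnegative variance of \<open>h\<close> under
  \<open>P x\<close>. It lives in the extended reals because a function in
  \<open>L2_functions \<pi>\<close> need not be square integrable under every \<open>P x\<close>;
  where it is not, the bound is trivial.\<close>

lemma markov_operator_square_le:
  assumes x: "x \<in> space B" and h: "h \<in> borel_measurable B"
  shows "ennreal ((markov_operator P h x)\<^sup>2) \<le> (\<integral>\<^sup>+y. ennreal ((h y)\<^sup>2) \<partial>P x)"
proof (cases "(\<integral>\<^sup>+y. ennreal ((h y)\<^sup>2) \<partial>P x) = \<infinity>")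
  case False
  interpret Px: prob_space "P x"
    by (rule prob_space_kernel[OF x])
  have m: "h \<in> borel_measurable (P x)"
    using h sets_kernel_eq[OF x] by (simp cong: measurable_cong_sets)
  have i2: "integrable (P x) (\<lambda>y. (h y)\<^sup>2)"
  proof (rule integrableI_bounded)
    show "(\<integral>\<^sup>+y. ennreal (norm ((h y)\<^sup>2)) \<partial>P x) < \<infinity>"
      using False by (simp add: less_top[symmetric])
  qed (use m in simp)
  then have i: "integrable (P x) h"
    using Px.square_integrable_imp_integrable[OF m] by blast
  have "(markov_operator P h x)\<^sup>2 \<le> (\<integral>y. (h y)\<^sup>2 \<partial>P x)"
    using Px.variance_eq[OF i i2] Px.variance_positive[of h] by (simp add: markov_operator_def)
  then have "ennreal ((markov_operator P h x)\<^sup>2) \<le> ennreal (\<integral>y. (h y)\<^sup>2 \<partial>P x)"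
    by (rule ennreal_leI)
  also have "\<dots> = (\<integral>\<^sup>+y. ennreal ((h y)\<^sup>2) \<partial>P x)"
    using i2 by (intro nn_integral_eq_integral[symmetric]) auto
  finally show ?thesis .
qed simp

text \<open>Jensen's inequality integrated against the invariant \<pi>. It makes the supremum
  defining \<lambda> finite and covers functions of norm 0, which cannot be normalized.\<close>

lemma L2_contraction:
  assumes "h \<in> L2_functions \<pi>"
  shows "(\<integral>x. (markov_operator P h x)\<^sup>2 \<partial>\<pi>) \<le> (\<integral>x. (h x)\<^sup>2 \<partial>\<pi>)"
proof -
  have h [measurable]: "h \<in> borel_measurable B" and i: "integrable \<pi> (\<lambda>x. (h x)\<^sup>2)"
    using assms by (auto simp: L2_functions_def cong: measurable_cong_sets)
  have "(\<integral>\<^sup>+x. ennreal ((markov_operator P h x)\<^sup>2) \<partial>\<pi>) \<le> (\<integral>\<^sup>+x. \<integral>\<^sup>+y. ennreal ((h y)\<^sup>2) \<partial>P x \<partial>\<pi>)"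
    by (intro nn_integral_mono markov_operator_square_le) auto
  also have "\<dots> = (\<integral>\<^sup>+x. ennreal ((h x)\<^sup>2) \<partial>\<pi>)"
    by (rule nn_integral_kernel) simp
  also have "\<dots> = ennreal (\<integral>x. (h x)\<^sup>2 \<partial>\<pi>)"
    using i by (rule nn_integral_eq_integral) simp
  finally show ?thesis
    by (intro integral_real_bounded) auto
qed

lemma spectral_lambda_bdd:
  "bdd_above (insert 0 {L2_norm \<pi> (markov_operator P h) | h.
      h \<in> L2_functions \<pi> \<and> L2_norm \<pi> h = 1 \<and> (\<integral>x. h x \<partial>\<pi>) = 0})"
  by (intro bdd_aboveI[of _ 1]) (auto simp: L2_norm_def dest!: L2_contraction)

lemma spectral_lambda_nonneg: "0 \<le> spectral_lambda P \<pi>"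
  unfolding spectral_lambda_def by (intro cSup_upper spectral_lambda_bdd) simp

text \<open>The supremum ranges over unit vectors, so \<open>h\<close> is divided by its norm; norm
  0 falls under \<open>L2_contraction\<close>.\<close>

lemma spectral_contraction:
  assumes h: "h \<in> bounded_borel B" and h0: "(\<integral>x. h x \<partial>\<pi>) = 0"
  shows "(\<integral>x. (markov_operator P h x)\<^sup>2 \<partial>\<pi>) \<le> (spectral_lambda P \<pi>)\<^sup>2 * (\<integral>x. (h x)\<^sup>2 \<partial>\<pi>)"
proof -
  define N where "N = (\<integral>x. (h x)\<^sup>2 \<partial>\<pi>)"
  have L2: "g \<in> L2_functions \<pi>" if "g \<in> bounded_borel B" for g
    using that by (auto simp: L2_functions_def bounded_borel_eq[symmetric] bounded_borel_measurable)
  have "N \<ge> 0"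
    by (simp add: N_def)
  show ?thesis
  proof (cases "N = 0")
    case True
    then show ?thesis
      using L2_contraction[OF L2[OF h]] by (simp add: N_def)
  next
    case False
    with \<open>N \<ge> 0\<close> have "N > 0" by simp
    define g where "g = (\<lambda>x. inverse (sqrt N) * h x)"
    have g: "g \<in> bounded_borel B"
      unfolding g_def by (intro bounded_borel_mult bounded_borel_const h)
    have Pg: "markov_operator P g x = inverse (sqrt N) * markov_operator P h x" for x
      by (simp add: markov_operator_def g_def)
    have "L2_norm \<pi> g = 1"
      using \<open>N > 0\<close> by (simp add: L2_norm_def g_def power_mult_distrib power_inverse N_def[symmetric])
    moreover have "(\<integral>x. g x \<partial>\<pi>) = 0"
      using h0 by (simp add: g_def)
    ultimately have "L2_norm \<pi> (markov_operator P g) \<le> spectral_lambda P \<pi>"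
      unfolding spectral_lambda_def using L2[OF g] by (intro cSup_upper spectral_lambda_bdd) auto
    then have "(L2_norm \<pi> (markov_operator P g))\<^sup>2 \<le> (spectral_lambda P \<pi>)\<^sup>2"
      by (intro power_mono) (auto simp: L2_norm_def)
    moreover have "(L2_norm \<pi> (markov_operator P g))\<^sup>2 = inverse N * (\<integral>x. (markov_operator P h x)\<^sup>2 \<partial>\<pi>)"
      using \<open>N > 0\<close> by (simp add: L2_norm_def Pg power_mult_distrib power_inverse)
    ultimately show ?thesis
      using \<open>N > 0\<close> by (simp add: N_def[symmetric] field_simps)
  qed
qed

text \<open>The quadratic form of the kernel that stays put with probability \<lambda> and otherwise
  draws a fresh point from \<pi>.\<close>

definition lp_form :: "('a \<Rightarrow> real) \<Rightarrow> real" where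
  "lp_form v = spectral_lambda P \<pi> * expectation (\<lambda>x. (v x)\<^sup>2)
     + (1 - spectral_lambda P \<pi>) * (expectation v)\<^sup>2"

text \<open>The functions split into mean and centred part, and the centred parts contribute at most
  \<lambda> times the product of their norms. What remains is Cauchy-Schwarz in the plane, for the
  vectors formed by the mean and the square root of \<lambda> times the centred norm.\<close>

lemma kernel_form_bound:
  assumes g: "g \<in> bounded_borel B" and h: "h \<in> bounded_borel B"
  shows "(expectation (\<lambda>x. g x * markov_operator P h x))\<^sup>2 \<le> lp_form g * lp_form h"
proof -
  define l where "l = spectral_lambda P \<pi>"
  define g0 h0 where "g0 = (\<lambda>x. g x - expectation g)" and "h0 = (\<lambda>x. h x - expectation h)"
  have l: "0 \<le> l"
    by (simp add: l_def spectral_lambda_nonneg)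
  have b: "g0 \<in> bounded_borel B" "h0 \<in> bounded_borel B"
    unfolding g0_def h0_def by (intro bounded_borel_diff bounded_borel_const g h)+
  note pb = bounded_borel_markov_operator
  have int: "integrable \<pi> u" if "u \<in> bounded_borel B" for u
    using that by (simp add: bounded_borel_eq[symmetric] integrable_bounded_borel)
  have mean0: "expectation h0 = 0"
    using int[OF h] by (simp add: h0_def prob_space)
  \<comment> \<open>The cross terms vanish: \<open>P\<close> fixes constants, and by invariance it
    preserves the mean under \<pi>.\<close>
  have decomp: "expectation (\<lambda>x. g x * markov_operator P h x)
      = expectation g * expectation h + expectation (\<lambda>x. g0 x * markov_operator P h0 x)"
  proof -
    have Ph: "markov_operator P h0 x = markov_operator P h x - expectation h" if "x \<in> space B" for x
    proof -
      interpret Px: prob_space "P x"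
        by (rule prob_space_kernel[OF that])
      show ?thesis
        using integrable_kernel[OF that h] by (simp add: markov_operator_def h0_def Px.prob_space)
    qed
    have "expectation (\<lambda>x. g0 x * markov_operator P h0 x)
        = expectation (\<lambda>x. g x * markov_operator P h x - expectation h * g x
            - expectation g * markov_operator P h x + expectation g * expectation h)"
      by (intro Bochner_Integration.integral_cong) (auto simp: Ph g0_def algebra_simps)
    also have "\<dots> = expectation (\<lambda>x. g x * markov_operator P h x) - expectation g * expectation h"
      using int[OF g] int[OF pb[OF h]] int[OF bounded_borel_mult[OF g pb[OF h]]]
      by (simp add: integral_markov_operator[OF h] prob_space)
    finally show ?thesis
      by simp
  qed
  have centre: "lp_form v = (expectation v)\<^sup>2 + l * expectation (\<lambda>x. (v x - expectation v)\<^sup>2)"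
    if "v \<in> bounded_borel B" for v
  proof -
    have "expectation (\<lambda>x. (v x)\<^sup>2) = (expectation v)\<^sup>2 + expectation (\<lambda>x. (v x - expectation v)\<^sup>2)"
      using variance_eq[OF int[OF that] int[OF bounded_borel_power[OF that]]] by simp
    then show ?thesis
      unfolding lp_form_def l_def by algebra
  qed
  define x y z u v where "x = expectation g" and "y = expectation h"
    and "z = expectation (\<lambda>x. g0 x * markov_operator P h0 x)"
    and "u = expectation (\<lambda>x. (g0 x)\<^sup>2)" and "v = expectation (\<lambda>x. (h0 x)\<^sup>2)"
  have uv: "u \<ge> 0" "v \<ge> 0"
    by (simp_all add: u_def v_def)
  have "z\<^sup>2 \<le> u * expectation (\<lambda>x. (markov_operator P h0 x)\<^sup>2)"
    unfolding z_def u_def using b pb by (intro Cauchy_Schwarz_bounded_borel) (simp_all add: bounded_borel_eq)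
  also have "\<dots> \<le> u * (l\<^sup>2 * v)"
    unfolding l_def v_def using spectral_contraction[OF b(2) mean0] uv by (intro mult_left_mono)
  finally have z: "z\<^sup>2 \<le> l\<^sup>2 * u * v"
    by (simp add: mult_ac)
  define r where "r = sqrt u * sqrt v"
  have r: "r \<ge> 0" "r\<^sup>2 = u * v"
    using uv by (auto simp: r_def power_mult_distrib)
  have "\<bar>z\<bar> \<le> l * r"
  proof (rule power2_le_imp_le)
    show "\<bar>z\<bar>\<^sup>2 \<le> (l * r)\<^sup>2"
      using z r by (simp add: power_mult_distrib mult.assoc)
  qed (use l r in simp)
  then have "\<bar>x * y + z\<bar> \<le> \<bar>x * y\<bar> + l * r"
    by linarith
  then have "(x * y + z)\<^sup>2 \<le> (\<bar>x * y\<bar> + l * r)\<^sup>2"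
    using l r by (subst power2_le_iff_abs_le) auto
  \<comment> \<open>The cross term is regrouped so that each factor pairs one function's mean with
    the other's centred norm; the arithmetic-geometric inequality then produces the mixed terms of
    the target product.\<close>
  also have "\<dots> = (x * y)\<^sup>2 + l * (2 * (\<bar>x\<bar> * sqrt v) * (\<bar>y\<bar> * sqrt u)) + l\<^sup>2 * (u * v)"
    by (simp add: power2_sum abs_mult power_mult_distrib r(2)) (simp add: r_def algebra_simps)
  also have "\<dots> \<le> (x * y)\<^sup>2 + l * ((\<bar>x\<bar> * sqrt v)\<^sup>2 + (\<bar>y\<bar> * sqrt u)\<^sup>2) + l\<^sup>2 * (u * v)"
    using l by (intro add_right_mono add_left_mono mult_left_mono sum_squares_bound)
  also have "\<dots> = (x\<^sup>2 + l * u) * (y\<^sup>2 + l * v)"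
    using uv by (simp add: power_mult_distrib) (simp add: power2_eq_square algebra_simps)
  finally show ?thesis
    unfolding decomp centre[OF g] centre[OF h] g0_def[symmetric] h0_def[symmetric]
      x_def y_def z_def u_def v_def by (simp add: g0_def h0_def)
qed

end

section \<open>The backward recursion\<close>

text \<open>The Feynman-Kac functional: the expected product of \<open>E m\<close> up to
  \<open>E (m + k)\<close> along a chain that is at \<open>x\<close> at time \<open>m\<close>. As
  \<open>k\<close> counts kernel steps, there are \<open>k + 1\<close> factors.\<close>

primrec feynman_kac ::
    "('a \<Rightarrow> 'a measure) \<Rightarrow> (nat \<Rightarrow> 'a \<Rightarrow> real) \<Rightarrow> nat \<Rightarrow> nat \<Rightarrow> 'a \<Rightarrow> real" where
  "feynman_kac P E 0 m = E m"
| "feynman_kac P E (Suc k) m = (\<lambda>x. E m x * markov_operator P (feynman_kac P E k (Suc m)) x)"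

lemma feynman_kac_nonneg:
  assumes "\<And>m x. 0 \<le> E m x"
  shows "0 \<le> feynman_kac P E k m x"
  using assms by (induction k arbitrary: m x) (auto simp: markov_operator_def intro!: mult_nonneg_nonneg Bochner_Integration.integral_nonneg)

context stationary_kernel
begin

lemma bounded_borel_feynman_kac:
  assumes "\<And>m. E m \<in> bounded_borel B"
  shows "feynman_kac P E k m \<in> bounded_borel B"
  by (induction k arbitrary: m) (auto intro!: assms bounded_borel_mult bounded_borel_markov_operator)

lemma integrable_bounded_borel_B: "v \<in> bounded_borel B \<Longrightarrow> integrable \<pi> v"
  by (simp add: bounded_borel_eq[symmetric] integrable_bounded_borel)

text \<open>The difference of the two sides is \<lambda> times the variance of
  \<open>v\<close>.\<close>

lemma square_expectation_le_lp_form: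
  assumes "v \<in> bounded_borel B"
  shows "(expectation v)\<^sup>2 \<le> lp_form v"
proof -
  have "0 \<le> spectral_lambda P \<pi> * (expectation (\<lambda>x. (v x)\<^sup>2) - (expectation v)\<^sup>2)"
    using variance_positive[of v] spectral_lambda_nonneg
      variance_eq[OF integrable_bounded_borel_B[OF assms] integrable_bounded_borel_B[OF bounded_borel_power[OF assms]]]
    by simp
  then show ?thesis
    by (simp add: lp_form_def algebra_simps)
qed

text \<open>The estimate is propagated in the weighted square norm \<open>H\<close>, where a
  recursion step becomes the bilinear form of \<open>P\<close> between two successive functionals.
  \<open>kernel_form_bound\<close> and \<open>form\<close> bound its square by a product containing
  \<open>H\<close> itself, which cancels.\<close>

lemma feynman_kac_mean_bound:
  fixes f :: "nat \<Rightarrow> 'a \<Rightarrow> real" and a b :: "nat \<Rightarrow> real" and t :: real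
  assumes gap: "spectral_lambda P \<pi> < 1"
    and f: "\<And>i. f i \<in> borel_measurable B"
    and ab: "\<And>i x. x \<in> space B \<Longrightarrow> f i x \<in> {a i..b i}"
    and f0: "\<And>i. expectation (f i) = 0"
  defines "C \<equiv> \<lambda>i. exp (alpha (spectral_lambda P \<pi>) * (t * (b i - a i))\<^sup>2 / 8)"
    and "E \<equiv> \<lambda>i x. exp (t * f i x)"
  shows "expectation (feynman_kac P E k m) \<le> (\<Prod>i\<in>{m..m + k}. C i)"
proof -
  define H where "H = (\<lambda>k m. expectation (\<lambda>x. (feynman_kac P E k m x)\<^sup>2 * exp (- (t * f m x))))"
  have fb: "f i \<in> bounded_borel B" for i
  proof (rule bounded_borelI[OF f])
    show "\<bar>f i x\<bar> \<le> \<bar>a i\<bar> + \<bar>b i\<bar>" if "x \<in> space B" for x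
      using ab[OF that, of i] by auto
  qed
  have Eb: "E i \<in> bounded_borel B" for i
    unfolding E_def by (intro bounded_borel_exp bounded_borel_mult bounded_borel_const fb)
  have gb: "feynman_kac P E k m \<in> bounded_borel B" for k m
    by (intro bounded_borel_feynman_kac Eb)
  have Cpos: "C i > 0" for i
    by (simp add: C_def)
  have H0: "H k m \<ge> 0" for k m
    by (simp add: H_def)
  have form: "lp_form v \<le> C m * expectation (\<lambda>x. (v x)\<^sup>2 * exp (- (t * f m x)))"
    if "v \<in> bounded_borel B" for v m
    unfolding lp_form_def using that f ab f0 gap spectral_lambda_nonneg
    by (intro leon_perron_quadratic_form_bound[where f = "f m" and a = "a m" and b = "b m"])
       (auto simp: C_def bounded_borel_eq cong: measurable_cong_sets)
  have cancel: "E m x * exp (- (t * f m x)) = 1" for m x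
    by (simp add: E_def flip: exp_add)
  \<comment> \<open>The left-hand side is the bound for the squared mean used at the end, which is
    why the constants are squared.\<close>
  have weighted: "C m * H k m \<le> (\<Prod>i\<in>{m..m + k}. (C i)\<^sup>2)" for k m
  proof (induction k arbitrary: m)
    case 0
    \<comment> \<open>With no steps left the weight cancels one of the two factors
      \<open>E m\<close>, and \<open>H 0 m\<close> bounds itself through
      \<open>(H 0 m)\<^sup>2 \<le> C m * H 0 m\<close>.\<close>
    have H_eq: "H 0 m = expectation (E m)"
      unfolding H_def using cancel by (simp add: power2_eq_square mult.assoc)
    have "(H 0 m)\<^sup>2 \<le> C m * H 0 m"
      using order_trans[OF square_expectation_le_lp_form[OF Eb[of m]] form[OF Eb[of m], of m]]
        H_eq by (simp add: H_def)
    then have "H 0 m \<le> C m"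
      using H0[of 0 m] Cpos[of m] by (cases "H 0 m = 0") (auto simp: power2_eq_square)
    then show ?case
      using Cpos[of m] by (simp add: power2_eq_square)
  next
    case (Suc k)
    define h h' where "h = H (Suc k) m" and "h' = H k (Suc m)"
    \<comment> \<open>The weight cancels one of the two factors \<open>E m x\<close> and leaves a
      pairing through \<open>P\<close>.\<close>
    have "(feynman_kac P E (Suc k) m x)\<^sup>2 * exp (- (t * f m x))
        = feynman_kac P E (Suc k) m x * markov_operator P (feynman_kac P E k (Suc m)) x" for x
      using cancel[of m x] by (simp add: power2_eq_square)
    then have "h = expectation (\<lambda>x. feynman_kac P E (Suc k) m x * markov_operator P (feynman_kac P E k (Suc m)) x)"
      unfolding h_def H_def by presburger
    then have "h\<^sup>2 \<le> lp_form (feynman_kac P E (Suc k) m) * lp_form (feynman_kac P E k (Suc m))"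
      using kernel_form_bound[OF gb[of "Suc k" m] gb[of k "Suc m"]] by (simp only:)
    also have "\<dots> \<le> (C m * h) * (C (Suc m) * h')"
      using form[OF gb, of "Suc k" m m] form[OF gb, of k "Suc m" "Suc m"] Cpos[of m] H0[of "Suc k" m]
        order_trans[OF zero_le_power2 square_expectation_le_lp_form[OF gb]]
      unfolding h_def h'_def H_def by (intro mult_mono) auto
    finally have "h * h \<le> (C m * (C (Suc m) * h')) * h"
      by (simp add: power2_eq_square mult_ac)
    then have "h \<le> C m * (C (Suc m) * h')"
      using H0[of "Suc k" m] H0[of k "Suc m"] Cpos[of m] Cpos[of "Suc m"]
      by (cases "h = 0") (auto simp: h_def h'_def)
    then have "C m * h \<le> C m * (C m * (C (Suc m) * h'))"
      using Cpos[of m] by simp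
    also have "\<dots> = (C m)\<^sup>2 * (C (Suc m) * h')"
      by (simp add: power2_eq_square)
    also have "\<dots> \<le> (C m)\<^sup>2 * (\<Prod>i\<in>{Suc m..Suc m + k}. (C i)\<^sup>2)"
      unfolding h'_def by (intro mult_left_mono Suc.IH) simp
    also have "\<dots> = (\<Prod>i\<in>{m..m + Suc k}. (C i)\<^sup>2)"
      by (subst prod.atLeast_Suc_atMost[of m "m + Suc k"]) auto
    finally show ?case
      by (simp add: h_def)
  qed
  have "(expectation (feynman_kac P E k m))\<^sup>2 \<le> C m * H k m"
    using square_expectation_le_lp_form[OF gb] form[OF gb, of k m m] unfolding H_def by (rule order_trans)
  also have "\<dots> \<le> (\<Prod>i\<in>{m..m + k}. C i)\<^sup>2"
    using weighted by (simp add: prod_power_distrib)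
  finally show ?thesis
    by (rule power2_le_imp_le) (intro prod_nonneg less_imp_le[OF Cpos])
qed

end

section \<open>The Markov property and integrals along the path\<close>

lemma subalgebra_natural_filtration:
  assumes "\<And>i. i \<ge> 1 \<Longrightarrow> X i \<in> measurable M B"
  shows "subalgebra M (natural_filtration M B X i)"
  unfolding subalgebra_def natural_filtration_def
proof (intro conjI sets.sigma_sets_subset space_measure_of)
  show "(\<Union>j\<in>{1..i}. {X j -` A \<inter> space M |A. A \<in> sets B}) \<subseteq> Pow (space M)"
    by auto
  then show "sets (sigma (space M) (\<Union>j\<in>{1..i}. {X j -` A \<inter> space M |A. A \<in> sets B})) \<subseteq> sets M"
    using assms by (subst sets_measure_of) (auto intro!: sets.sigma_sets_subset measurable_sets)
qed

lemma measurable_natural_filtration: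
  assumes "X j \<in> measurable M B" "j \<in> {1..i}"
  shows "X j \<in> measurable (natural_filtration M B X i) B"
proof (rule measurableI)
  have sub: "(\<Union>j\<in>{1..i}. {X j -` A \<inter> space M |A. A \<in> sets B}) \<subseteq> Pow (space M)"
    by auto
  show "X j x \<in> space B" if "x \<in> space (natural_filtration M B X i)" for x
    using that assms(1)[THEN measurable_space] sub by (simp add: natural_filtration_def space_measure_of)
  show "X j -` A \<inter> space (natural_filtration M B X i) \<in> sets (natural_filtration M B X i)"
    if "A \<in> sets B" for A
    unfolding natural_filtration_def space_measure_of[OF sub] sets_measure_of[OF sub]
    using that assms(2) by (intro sigma_sets.Basic UN_I[of j]) auto
qed

text \<open>The chain hypothesis speaks of indicators only. Weighting \<open>M\<close> by the past
  \<open>Y\<close> makes it an identity of measures, the law of \<open>X (Suc i)\<close> being that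
  of \<open>X i\<close> followed by \<open>P\<close>, and this extends to all nonnegative
  \<open>g\<close>.\<close>

lemma markov_step:
  fixes M :: "'w measure" and B :: "'a measure" and Y :: "'w \<Rightarrow> real"
  assumes chain: "markov_chain M B P X" and i: "1 \<le> i"
    and Y: "Y \<in> borel_measurable (natural_filtration M B X i)"
    and Yb: "\<And>w. w \<in> space M \<Longrightarrow> 0 \<le> Y w" "\<And>w. w \<in> space M \<Longrightarrow> Y w \<le> K"
    and g: "g \<in> borel_measurable B"
  shows "(\<integral>\<^sup>+w. ennreal (Y w) * g (X (Suc i) w) \<partial>M)
    = (\<integral>\<^sup>+w. ennreal (Y w) * (\<integral>\<^sup>+y. g y \<partial>P (X i w)) \<partial>M)"
proof -
  let ?F = "natural_filtration M B X i"
  interpret prob_space M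
    using chain by (simp add: markov_chain_def)
  have X: "X j \<in> measurable M B" if "j \<ge> 1" for j
    using chain that by (simp add: markov_chain_def)
  note [measurable] = X[OF i] X[of "Suc i", simplified]
  have "P \<in> measurable B (prob_algebra B)"
    using chain by (simp add: markov_chain_def transition_kernel_def)
  then have P [measurable]: "P \<in> measurable B (subprob_algebra B)"
    by (rule measurable_prob_algebraD)
  have Pprob: "prob_space (P x)" if "x \<in> space B" for x
    using measurable_space[OF \<open>P \<in> measurable B (prob_algebra B)\<close> that] by (simp add: space_prob_algebra)
  have sub: "subalgebra M ?F"
    by (rule subalgebra_natural_filtration[OF X])
  interpret F: finite_measure_subalgebra M ?F
    by unfold_locales (rule sub)
  have Ym [measurable]: "Y \<in> borel_measurable M"
    by (rule measurable_from_subalg[OF sub Y])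
  define D where "D = density M (\<lambda>w. ennreal (Y w))"
  have XD [measurable]: "X i \<in> measurable D B" "X (Suc i) \<in> measurable D B"
    by (simp_all add: D_def)
  have K0: "0 \<le> K"
    using not_empty Yb by (meson ex_in_conv order_trans)
  have ne: "space (distr D B (X i)) \<noteq> {}"
    using not_empty X[OF i, THEN measurable_space] by auto
  have "distr D B (X (Suc i)) = distr D B (X i) \<bind> P"
  proof (rule measure_eqI)
    show "sets (distr D B (X (Suc i))) = sets (distr D B (X i) \<bind> P)"
      using ne by (subst sets_bind[where N = B]) (auto simp: sets_kernel[OF P])
    fix A assume "A \<in> sets (distr D B (X (Suc i)))"
    then have A [measurable]: "A \<in> sets B"
      by simp
    let ?A = "X (Suc i) -` A \<inter> space M"
    have Am [measurable]: "?A \<in> sets M"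
      by measurable
    have mA: "(\<lambda>w. measure (P (X i w)) A) \<in> borel_measurable M"
      by measurable
    have i1: "integrable M (\<lambda>w. Y w * indicator ?A w)"
      using Yb K0 by (intro integrable_const_bound[of _ K]) (auto simp: indicator_def)
    have mP: "measure (P (X i w)) A \<le> 1" if "w \<in> space M" for w
      using Pprob[OF measurable_space[OF X[OF i] that]] by (simp add: prob_space.prob_le_1)
    have i2: "integrable M (\<lambda>w. Y w * measure (P (X i w)) A)"
    proof (rule integrable_const_bound[of _ K])
      show "AE w in M. norm (Y w * measure (P (X i w)) A) \<le> K"
      proof (rule AE_I2)
        fix w assume w: "w \<in> space M"
        show "norm (Y w * measure (P (X i w)) A) \<le> K"
          using mult_mono[OF Yb(2)[OF w] mP[OF w]] Yb[OF w] by (simp add: abs_mult)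
      qed
    qed (use mA in measurable)
    have "emeasure (distr D B (X (Suc i))) A = (\<integral>\<^sup>+w. ennreal (Y w) * indicator ?A w \<partial>M)"
      by (simp add: emeasure_distr D_def emeasure_density)
    also have "\<dots> = (\<integral>\<^sup>+w. ennreal (Y w * indicator ?A w) \<partial>M)"
      by (intro nn_integral_cong) (auto simp: indicator_def)
    also have "\<dots> = ennreal (\<integral>w. Y w * indicator ?A w \<partial>M)"
      using i1 Yb by (intro nn_integral_eq_integral) (auto simp: indicator_def)
    \<comment> \<open>\<open>Y\<close> is measurable for the past, so the indicator may be replaced
      by its conditional expectation, and then by the kernel.\<close>
    also have "(\<integral>w. Y w * indicator ?A w \<partial>M) = (\<integral>w. Y w * real_cond_exp M ?F (indicator ?A) w \<partial>M)"
      using i1 Y by (intro F.real_cond_exp_intg(2)[symmetric]) auto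
    also have "\<dots> = (\<integral>w. Y w * measure (P (X i w)) A \<partial>M)"
    proof (rule integral_cong_AE)
      have "AE w in M. real_cond_exp M ?F (indicator ?A) w = measure (P (X i w)) A"
        using chain i A by (auto simp: markov_chain_def)
      then show "AE w in M. Y w * real_cond_exp M ?F (indicator ?A) w = Y w * measure (P (X i w)) A"
        by eventually_elim simp
    qed (use mA in measurable)
    also have "ennreal \<dots> = (\<integral>\<^sup>+w. ennreal (Y w * measure (P (X i w)) A) \<partial>M)"
      using i2 Yb by (intro nn_integral_eq_integral[symmetric]) auto
    also have "\<dots> = (\<integral>\<^sup>+w. ennreal (Y w) * emeasure (P (X i w)) A \<partial>M)"
    proof (rule nn_integral_cong)
      fix w assume w: "w \<in> space M"
      interpret Pw: prob_space "P (X i w)"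
        by (rule Pprob[OF measurable_space[OF X[OF i] w]])
      show "ennreal (Y w * measure (P (X i w)) A) = ennreal (Y w) * emeasure (P (X i w)) A"
        using Yb(1)[OF w] by (simp add: ennreal_mult Pw.emeasure_eq_measure)
    qed
    also have "\<dots> = (\<integral>\<^sup>+w. emeasure (P (X i w)) A \<partial>D)"
      unfolding D_def by (intro nn_integral_density[symmetric]) measurable
    also have "\<dots> = (\<integral>\<^sup>+x. emeasure (P x) A \<partial>distr D B (X i))"
      by (intro nn_integral_distr[symmetric]) measurable
    also have "\<dots> = emeasure (distr D B (X i) \<bind> P) A"
      using ne by (intro emeasure_bind[symmetric, where N = B]) auto
    finally show "emeasure (distr D B (X (Suc i))) A = emeasure (distr D B (X i) \<bind> P) A" .
  qed
  then have "(\<integral>\<^sup>+x. g x \<partial>distr D B (X (Suc i))) = (\<integral>\<^sup>+x. \<integral>\<^sup>+y. g y \<partial>P x \<partial>distr D B (X i))"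
    using nn_integral_bind[OF g, of P "distr D B (X i)"] by simp
  moreover note [measurable] = g
  have [measurable]: "(\<lambda>x. \<integral>\<^sup>+y. g y \<partial>P x) \<in> borel_measurable B"
    by measurable
  ultimately show ?thesis
    by (simp add: nn_integral_distr D_def nn_integral_density)
qed

text \<open>Induction by \<open>markov_step\<close> with weight 1, followed by invariance. It serves
  to identify the mean of each \<open>f i (X i)\<close> with the one under \<pi>.\<close>

lemma stationary_marginal:
  assumes chain: "markov_chain M B P X" and inv: "invariant_prob_measure B P \<pi>"
    and start: "distr M B (X 1) = \<pi>" and "1 \<le> i"
  shows "distr M B (X i) = \<pi>"
  using \<open>1 \<le> i\<close>
proof (induction i rule: dec_induct)
  case (step i)
  interpret stationary_kernel B \<pi> P
    using chain inv by unfold_locales (auto simp: markov_chain_def)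
  have X [measurable]: "X i \<in> measurable M B" "X (Suc i) \<in> measurable M B"
    using chain step by (auto simp: markov_chain_def)
  show ?case
  proof (rule measure_eqI)
    fix A assume "A \<in> sets (distr M B (X (Suc i)))"
    then have A [measurable]: "A \<in> sets B"
      by simp
    have "emeasure (distr M B (X (Suc i))) A = (\<integral>\<^sup>+x. indicator A x \<partial>distr M B (X (Suc i)))"
      by simp
    also have "\<dots> = (\<integral>\<^sup>+w. ennreal 1 * indicator A (X (Suc i) w) \<partial>M)"
      by (subst nn_integral_distr) auto
    also have "\<dots> = (\<integral>\<^sup>+w. ennreal 1 * (\<integral>\<^sup>+y. indicator A y \<partial>P (X i w)) \<partial>M)"
      using step by (intro markov_step[OF chain, where K = 1]) auto
    also have "\<dots> = (\<integral>\<^sup>+x. \<integral>\<^sup>+y. indicator A y \<partial>P x \<partial>distr M B (X i))"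
      by (subst nn_integral_distr) auto
    also have "\<dots> = (\<integral>\<^sup>+x. indicator A x \<partial>\<pi>)"
      unfolding step.IH by (rule nn_integral_kernel) auto
    also have "\<dots> = emeasure \<pi> A"
      by simp
    finally show "emeasure (distr M B (X (Suc i))) A = emeasure \<pi> A" .
  qed simp
qed (rule start)

text \<open>Repeated conditioning: the factors before \<open>m\<close> form the weight, those from
  \<open>m\<close> on are averaged into the functional. At \<open>m = 1\<close> the weight is the
  empty product.\<close>

lemma nn_integral_prod_eq_feynman_kac:
  assumes chain: "markov_chain M B P X" and inv: "invariant_prob_measure B P \<pi>"
    and E: "\<And>i. E i \<in> bounded_borel B" and E0: "\<And>i x. 0 \<le> E i x" and "1 \<le> m"
  shows "(\<integral>\<^sup>+w. ennreal (\<Prod>i\<in>{1..<m}. E i (X i w)) * ennreal (feynman_kac P E k m (X m w)) \<partial>M)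
    = (\<integral>\<^sup>+w. ennreal (\<Prod>i\<in>{1..m + k}. E i (X i w)) \<partial>M)"
  using \<open>1 \<le> m\<close>
proof (induction k arbitrary: m)
  case 0
  have "ennreal (\<Prod>i\<in>{1..<m}. E i (X i w)) * ennreal (feynman_kac P E 0 m (X m w))
     = ennreal (\<Prod>i\<in>{1..m + 0}. E i (X i w))" for w
  proof -
    have "{1..m + 0} = insert m {1..<m}"
      using 0 by auto
    then show ?thesis
      using E0 by (simp add: prod_nonneg mult.commute flip: ennreal_mult)
  qed
  then show ?case
    by presburger
next
  case (Suc k)
  interpret stationary_kernel B \<pi> P
    using chain inv by unfold_locales (auto simp: markov_chain_def)
  have X: "X i \<in> measurable M B" if "i \<ge> 1" for i
    using chain that by (auto simp: markov_chain_def)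
  let ?g = "feynman_kac P E k (Suc m)"
  \<comment> \<open>The factor \<open>E m\<close> leaves the functional and joins the weight, which
    stays measurable at time \<open>m\<close>.\<close>
  let ?Y = "\<lambda>w. \<Prod>i\<in>{1..<Suc m}. E i (X i w)"
  have gb: "?g \<in> bounded_borel B"
    by (intro bounded_borel_feynman_kac E)
  have g0: "0 \<le> ?g x" for x
    by (intro feynman_kac_nonneg E0)
  have Y0: "0 \<le> ?Y w" for w
    by (intro prod_nonneg) (simp add: E0)
  have "\<exists>K. \<forall>i. \<forall>x\<in>space B. E i x \<le> K i"
  proof -
    have "\<exists>K. \<forall>x\<in>space B. E i x \<le> K" for i
      using bounded_borelE[OF E[of i]] by (metis abs_le_D1)
    then show ?thesis
      by metis
  qed
  then obtain K where K: "\<And>i x. x \<in> space B \<Longrightarrow> E i x \<le> K i"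
    by blast
  have "(\<integral>\<^sup>+w. ennreal (\<Prod>i\<in>{1..<m}. E i (X i w)) * ennreal (feynman_kac P E (Suc k) m (X m w)) \<partial>M)
    = (\<integral>\<^sup>+w. ennreal (?Y w) * (\<integral>\<^sup>+y. ennreal (?g y) \<partial>P (X m w)) \<partial>M)"
  proof (rule nn_integral_cong)
    fix w assume w: "w \<in> space M"
    have "X m w \<in> space B"
      using measurable_space[OF X[OF Suc.prems] w] .
    then have "(\<integral>\<^sup>+y. ennreal (?g y) \<partial>P (X m w)) = ennreal (markov_operator P ?g (X m w))"
      unfolding markov_operator_def using g0 gb by (intro nn_integral_eq_integral integrable_kernel) auto
    moreover have "0 \<le> markov_operator P ?g (X m w)"
      unfolding markov_operator_def using g0 by (intro Bochner_Integration.integral_nonneg) auto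
    ultimately show "ennreal (\<Prod>i\<in>{1..<m}. E i (X i w)) * ennreal (feynman_kac P E (Suc k) m (X m w))
        = ennreal (?Y w) * (\<integral>\<^sup>+y. ennreal (?g y) \<partial>P (X m w))"
      using Suc.prems E0 by (simp add: prod_nonneg mult.assoc flip: ennreal_mult)
  qed
  also have "\<dots> = (\<integral>\<^sup>+w. ennreal (?Y w) * ennreal (?g (X (Suc m) w)) \<partial>M)"
  proof (rule markov_step[OF chain Suc.prems, symmetric, where K = "\<Prod>i\<in>{1..<Suc m}. K i"])
    show "?Y \<in> borel_measurable (natural_filtration M B X m)"
    proof (rule borel_measurable_prod)
      fix i assume "i \<in> {1..<Suc m}"
      then have "X i \<in> measurable (natural_filtration M B X m) B"
        by (intro measurable_natural_filtration X) auto
      then show "(\<lambda>w. E i (X i w)) \<in> borel_measurable (natural_filtration M B X m)"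
        by (rule measurable_compose[OF _ bounded_borel_measurable[OF E]])
    qed
    show "?Y w \<le> (\<Prod>i\<in>{1..<Suc m}. K i)" if "w \<in> space M" for w
      using K E0 measurable_space[OF X that] by (intro prod_mono) auto
    show "(\<lambda>y. ennreal (?g y)) \<in> borel_measurable B"
      using gb[THEN bounded_borel_measurable] by measurable
  qed (rule Y0)
  also have "\<dots> = (\<integral>\<^sup>+w. ennreal (\<Prod>i\<in>{1..Suc m + k}. E i (X i w)) \<partial>M)"
    by (rule Suc.IH) simp
  finally show ?case
    by simp
qed

section \<open>Chernoff bounds\<close>

lemma (in prob_space) subgaussian_upper_tail:
  fixes S :: "'a \<Rightarrow> real"
  assumes v: "0 < v" and \<epsilon>: "0 < \<epsilon>"
    and int: "\<And>t. integrable M (\<lambda>w. exp (t * S w))"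
    and mgf: "\<And>t. expectation (\<lambda>w. exp (t * S w)) \<le> exp (v * t\<^sup>2 / 2)"
  shows "prob {w \<in> space M. S w \<ge> \<epsilon>} \<le> exp (- (\<epsilon>\<^sup>2 / (2 * v)))"
proof -
  \<comment> \<open>The minimizer of the exponent
    \<open>v * s\<^sup>2 / 2 - s * \<epsilon>\<close>.\<close>
  define s where "s = \<epsilon> / v"
  have s: "s > 0"
    using v \<epsilon> by (simp add: s_def)
  have "{w \<in> space M. S w \<ge> \<epsilon>} = {w \<in> space M. exp (s * S w) \<ge> exp (s * \<epsilon>)}"
    using s by simp
  also have "prob \<dots> \<le> expectation (\<lambda>w. exp (s * S w)) / exp (s * \<epsilon>)"
    by (rule integral_Markov_inequality_measure[where A = "space M"]) (auto intro: int)
  also have "\<dots> \<le> exp (v * s\<^sup>2 / 2) / exp (s * \<epsilon>)"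
    by (intro divide_right_mono mgf) simp
  also have "\<dots> = exp (- (\<epsilon>\<^sup>2 / (2 * v)))"
    using v by (simp add: s_def power2_eq_square field_simps flip: exp_diff)
  finally show ?thesis .
qed

lemma (in prob_space) subgaussian_two_sided_tail:
  fixes S :: "'a \<Rightarrow> real"
  assumes v: "0 < v" and \<epsilon>: "0 < \<epsilon>" and S: "S \<in> borel_measurable M"
    and int: "\<And>t. integrable M (\<lambda>w. exp (t * S w))"
    and mgf: "\<And>t. expectation (\<lambda>w. exp (t * S w)) \<le> exp (v * t\<^sup>2 / 2)"
  shows "prob {w \<in> space M. \<bar>S w\<bar> > \<epsilon>} \<le> 2 * exp (- (\<epsilon>\<^sup>2 / (2 * v)))"
proof -
  note [measurable] = S
  have "prob {w \<in> space M. \<bar>S w\<bar> > \<epsilon>} \<le> prob ({w \<in> space M. S w \<ge> \<epsilon>} \<union> {w \<in> space M. - S w \<ge> \<epsilon>})"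
    by (intro finite_measure_mono) (auto simp: abs_if split: if_splits)
  also have "\<dots> \<le> prob {w \<in> space M. S w \<ge> \<epsilon>} + prob {w \<in> space M. - S w \<ge> \<epsilon>}"
    by (intro measure_Un_le) measurable
  also have "prob {w \<in> space M. S w \<ge> \<epsilon>} \<le> exp (- (\<epsilon>\<^sup>2 / (2 * v)))"
    by (rule subgaussian_upper_tail[OF v \<epsilon> int mgf])
  also have "prob {w \<in> space M. - S w \<ge> \<epsilon>} \<le> exp (- (\<epsilon>\<^sup>2 / (2 * v)))"
    \<comment> \<open>The hypotheses cover every real \<open>t\<close>, hence also
      \<open>- S\<close>.\<close>
    using int[of "- t" for t] mgf[of "- t" for t] by (intro subgaussian_upper_tail[OF v \<epsilon>]) auto
  finally show ?thesis
    by simp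
qed

section \<open>The moment generating function of the chain\<close>

lemma stationary_chain_mgf_bound:
  fixes f :: "nat \<Rightarrow> 'a \<Rightarrow> real" and a b :: "nat \<Rightarrow> real" and t :: real and M :: "'w measure"
  assumes chain: "markov_chain M B P X" and inv: "invariant_prob_measure B P \<pi>"
    and gap: "spectral_lambda P \<pi> < 1"
    and start: "distr M B (X 1) = \<pi>" and n: "1 \<le> n"
    and f: "\<And>i. f i \<in> borel_measurable B"
    and ab: "\<And>i x. x \<in> space B \<Longrightarrow> f i x \<in> {a i..b i}"
    and f0: "\<And>i. (\<integral>x. f i x \<partial>\<pi>) = 0"
  shows "integrable M (\<lambda>w. exp (t * (\<Sum>i=1..n. f i (X i w))))" (is ?int)
    and "(\<integral>w. exp (t * (\<Sum>i=1..n. f i (X i w))) \<partial>M)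
      \<le> exp (t\<^sup>2 / 2 * alpha (spectral_lambda P \<pi>) * (\<Sum>i=1..n. (b i - a i)\<^sup>2 / 4))" (is ?le)
proof -
  define E where "E = (\<lambda>i x. exp (t * f i x))"
  interpret stationary_kernel B \<pi> P
    using chain inv by unfold_locales (auto simp: markov_chain_def)
  interpret M: prob_space M
    using chain by (simp add: markov_chain_def)
  have X: "X i \<in> measurable M B" if "i \<ge> 1" for i
    using chain that by (auto simp: markov_chain_def)
  have Eb: "E i \<in> bounded_borel B" for i
  proof -
    have "f i \<in> bounded_borel B"
    proof (rule bounded_borelI[OF f])
      show "\<bar>f i x\<bar> \<le> \<bar>a i\<bar> + \<bar>b i\<bar>" if "x \<in> space B" for x
        using ab[OF that, of i] by auto
    qed
    then show ?thesis
      unfolding E_def by (intro bounded_borel_exp bounded_borel_mult bounded_borel_const)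
  qed
  have E0: "0 \<le> E i x" for i x
    by (simp add: E_def)
  \<comment> \<open>\<open>n - 1\<close> kernel steps carry the \<open>n\<close> factors.\<close>
  let ?g = "feynman_kac P E (n - 1) 1"
  have gb: "?g \<in> bounded_borel B"
    by (intro bounded_borel_feynman_kac Eb)
  have g0: "0 \<le> ?g x" for x
    by (intro feynman_kac_nonneg E0)
  have prod: "exp (t * (\<Sum>i=1..n. f i (X i w))) = (\<Prod>i\<in>{1..n}. E i (X i w))" for w
    by (simp add: E_def sum_distrib_left exp_sum)
  have meas: "(\<lambda>w. exp (t * (\<Sum>i=1..n. f i (X i w)))) \<in> borel_measurable M"
    unfolding prod
    by (intro borel_measurable_prod measurable_compose[OF X bounded_borel_measurable[OF Eb]]) auto
  \<comment> \<open>Computing in the extended reals lets a single identity give both integrability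
    and the value.\<close>
  have "(\<integral>\<^sup>+w. ennreal (exp (t * (\<Sum>i=1..n. f i (X i w)))) \<partial>M) = (\<integral>\<^sup>+w. ennreal (?g (X 1 w)) \<partial>M)"
    unfolding prod
    using nn_integral_prod_eq_feynman_kac[OF chain inv, where E = E and m = 1 and k = "n - 1"] Eb E0 n
    by simp
  also have "\<dots> = (\<integral>\<^sup>+x. ennreal (?g x) \<partial>distr M B (X 1))"
    using X[of 1] gb[THEN bounded_borel_measurable] by (subst nn_integral_distr) auto
  also have "\<dots> = (\<integral>\<^sup>+x. ennreal (?g x) \<partial>\<pi>)"
    by (simp only: start)
  also have "\<dots> = ennreal (expectation ?g)"
    using g0 by (intro nn_integral_eq_integral integrable_bounded_borel_B gb) auto
  finally have mgf: "(\<integral>\<^sup>+w. ennreal (exp (t * (\<Sum>i=1..n. f i (X i w)))) \<partial>M) = ennreal (expectation ?g)" .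
  show ?int
    using mgf by (intro integrableI_bounded meas) simp
  have "(\<integral>w. exp (t * (\<Sum>i=1..n. f i (X i w))) \<partial>M) = enn2real (ennreal (expectation ?g))"
    unfolding mgf[symmetric] by (intro integral_eq_nn_integral meas) auto
  also have "\<dots> = expectation ?g"
    using g0 by simp
  also have "\<dots> \<le> (\<Prod>i\<in>{1..1 + (n - 1)}. exp (alpha (spectral_lambda P \<pi>) * (t * (b i - a i))\<^sup>2 / 8))"
    unfolding E_def using gap f ab f0 by (rule feynman_kac_mean_bound)
  also have "\<dots> = exp (\<Sum>i=1..n. alpha (spectral_lambda P \<pi>) * (t * (b i - a i))\<^sup>2 / 8)"
    using n by (simp add: exp_sum)
  also have "(\<Sum>i=1..n. alpha (spectral_lambda P \<pi>) * (t * (b i - a i))\<^sup>2 / 8)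
      = t\<^sup>2 / 2 * alpha (spectral_lambda P \<pi>) * (\<Sum>i=1..n. (b i - a i)\<^sup>2 / 4)"
    unfolding sum_distrib_left by (intro sum.cong) (auto simp: power_mult_distrib)
  finally show ?le .
qed

text \<open>Centring each \<open>f i\<close> reduces everything to
  \<open>stationary_chain_mgf_bound\<close>. If all intervals are single points, the tail exponent
  is formally minus infinity and the bound is stated as 0, where division by zero would yield
  2.\<close>

theorem theorem2p1:
  fixes B \<pi> :: "'a measure"
    and P :: "'a \<Rightarrow> 'a measure"
    and M :: "'w measure"
    and X :: "nat \<Rightarrow> 'w \<Rightarrow> 'a"
    and f :: "nat \<Rightarrow> 'a \<Rightarrow> real"
    and a b :: "nat \<Rightarrow> real"
    and n :: nat
  assumes "standard_borel_space B"
    and "markov_chain M B P X"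
    and "invariant_prob_measure B P \<pi>"
    and "spectral_lambda P \<pi> < 1"
    and "distr M B (X 1) = \<pi>"
    and "n \<ge> 1"
    and "\<And>i. i \<in> {1..n} \<Longrightarrow> f i \<in> borel_measurable B"
    and "\<And>i x. i \<in> {1..n} \<Longrightarrow> x \<in> space B \<Longrightarrow> f i x \<in> {a i..b i}"
  shows "sub_gaussian M (\<lambda>w. \<Sum>i=1..n. f i (X i w))
           (alpha (spectral_lambda P \<pi>) * (\<Sum>i=1..n. (b i - a i)\<^sup>2 / 4))
       \<and> (\<forall>t::real.
           integrable M (\<lambda>w. exp (t * (\<Sum>i=1..n. f i (X i w) - (\<integral>x. f i x \<partial>\<pi>)))) \<and>
           (\<integral>w. exp (t * (\<Sum>i=1..n. f i (X i w) - (\<integral>x. f i x \<partial>\<pi>))) \<partial>M)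
             \<le> exp (t\<^sup>2 / 2 * alpha (spectral_lambda P \<pi>) * (\<Sum>i=1..n. (b i - a i)\<^sup>2 / 4)))
       \<and> (\<forall>\<epsilon>>0.
           measure M {w \<in> space M.
               \<bar>(\<Sum>i=1..n. f i (X i w)) - (\<Sum>i=1..n. \<integral>x. f i x \<partial>\<pi>)\<bar> > \<epsilon>}
             \<le> (if (\<Sum>i=1..n. (b i - a i)\<^sup>2 / 4) = 0 then 0
                else 2 * exp (- (inverse (alpha (spectral_lambda P \<pi>)) * \<epsilon>\<^sup>2
                                 / (2 * (\<Sum>i=1..n. (b i - a i)\<^sup>2 / 4))))))"
proof -
  note chain = assms(2) and inv = assms(3) and gap = assms(4) and start = assms(5) and n = assms(6)
  interpret stationary_kernel B \<pi> P
    using chain inv by unfold_locales (auto simp: markov_chain_def)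
  interpret M: prob_space M
    using chain by (simp add: markov_chain_def)
  have X: "X i \<in> measurable M B" if "i \<ge> 1" for i
    using chain that by (auto simp: markov_chain_def)
  define V where "V = (\<Sum>i=1..n. (b i - a i)\<^sup>2 / 4)"
  define \<alpha> where "\<alpha> = alpha (spectral_lambda P \<pi>)"
  define \<mu> where "\<mu> = (\<lambda>i. \<integral>x. f i x \<partial>\<pi>)"
  define S where "S = (\<lambda>w. \<Sum>i=1..n. f i (X i w) - \<mu> i)"
  have \<alpha>: "\<alpha> > 0"
    using gap spectral_lambda_nonneg by (simp add: \<alpha>_def alpha_def)
  have fb: "f i \<in> bounded_borel B" if "i \<in> {1..n}" for i
  proof (rule bounded_borelI)
    show "\<bar>f i x\<bar> \<le> \<bar>a i\<bar> + \<bar>b i\<bar>" if "x \<in> space B" for x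
      using assms(8)[OF \<open>i \<in> {1..n}\<close> that] by auto
  qed (rule assms(7)[OF that])
  have fX: "integrable M (\<lambda>w. f i (X i w))" "(\<integral>w. f i (X i w) \<partial>M) = \<mu> i" if i: "i \<in> {1..n}" for i
  proof -
    have Xi: "X i \<in> measurable M B" and law: "distr M B (X i) = \<pi>"
      using X stationary_marginal[OF chain inv start] i by auto
    show "integrable M (\<lambda>w. f i (X i w))"
      using integrable_bounded_borel_B[OF fb[OF i]] assms(7)[OF i]
      unfolding law[symmetric] by (simp add: integrable_distr_eq[OF Xi])
    show "(\<integral>w. f i (X i w) \<partial>M) = \<mu> i"
      unfolding \<mu>_def law[symmetric] by (simp add: integral_distr[OF Xi assms(7)[OF i]])
  qed
  have intS: "integrable M (\<lambda>w. \<Sum>i=1..n. f i (X i w))"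
    using fX by auto
  have meanS: "(\<integral>w. (\<Sum>i=1..n. f i (X i w)) \<partial>M) = (\<Sum>i=1..n. \<mu> i)"
    using fX by (subst Bochner_Integration.integral_sum) auto
  have S_eq: "S w = (\<Sum>i=1..n. f i (X i w)) - (\<Sum>i=1..n. \<mu> i)" for w
    by (simp add: S_def sum_subtractf)
  have S_meas: "S \<in> borel_measurable M"
    using intS unfolding S_eq[abs_def] by auto
  have mgf: "integrable M (\<lambda>w. exp (t * S w))" "(\<integral>w. exp (t * S w) \<partial>M) \<le> exp (t\<^sup>2 / 2 * \<alpha> * V)" for t
  proof -
    \<comment> \<open>The bound for mean-zero functions asks for its hypotheses at every index, so
      the functions are extended by 0 outside \<open>{1..n}\<close>. Centring shifts the endpoints
      and keeps the widths.\<close>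
    define f' a' b' where "f' = (\<lambda>i x. if i \<in> {1..n} then f i x - \<mu> i else 0)"
      and "a' = (\<lambda>i. if i \<in> {1..n} then a i - \<mu> i else 0)"
      and "b' = (\<lambda>i. if i \<in> {1..n} then b i - \<mu> i else 0)"
    have "f' i \<in> borel_measurable B" for i
      using assms(7)[of i] by (cases "i \<in> {1..n}") (auto simp: f'_def)
    moreover have "f' i x \<in> {a' i..b' i}" if "x \<in> space B" for i x
      using assms(8)[of i x] that by (auto simp: f'_def a'_def b'_def)
    moreover have "expectation (f' i) = 0" for i
      using integrable_bounded_borel_B[OF fb[of i]] by (cases "i \<in> {1..n}") (auto simp: f'_def \<mu>_def prob_space)
    ultimately have *: "integrable M (\<lambda>w. exp (t * (\<Sum>i=1..n. f' i (X i w))))"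
      "(\<integral>w. exp (t * (\<Sum>i=1..n. f' i (X i w))) \<partial>M)
        \<le> exp (t\<^sup>2 / 2 * alpha (spectral_lambda P \<pi>) * (\<Sum>i=1..n. (b' i - a' i)\<^sup>2 / 4))"
      using stationary_chain_mgf_bound[OF chain inv gap start n, of f' a' b' t] by blast+
    have "(\<Sum>i=1..n. f' i (X i w)) = S w" for w
      unfolding S_def by (intro sum.cong) (auto simp: f'_def)
    moreover have "(\<Sum>i=1..n. (b' i - a' i)\<^sup>2 / 4) = V"
      unfolding V_def by (intro sum.cong) (auto simp: a'_def b'_def)
    ultimately show "integrable M (\<lambda>w. exp (t * S w))" "(\<integral>w. exp (t * S w) \<partial>M) \<le> exp (t\<^sup>2 / 2 * \<alpha> * V)"
      using * by (simp_all add: \<alpha>_def)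
  qed
  have mgf': "(\<integral>w. exp (t * S w) \<partial>M) \<le> exp (\<alpha> * V * t\<^sup>2 / 2)" for t
    using mgf(2)[of t] by (simp add: mult_ac)
  have sub_gaussian: "sub_gaussian M (\<lambda>w. \<Sum>i=1..n. f i (X i w)) (\<alpha> * V)"
    unfolding sub_gaussian_def meanS using intS mgf(1) mgf' by (simp add: S_eq)
  have tail: "measure M {w \<in> space M. \<epsilon> < \<bar>S w\<bar>}
      \<le> (if V = 0 then 0 else 2 * exp (- (inverse \<alpha> * \<epsilon>\<^sup>2 / (2 * V))))" if \<epsilon>: "\<epsilon> > 0" for \<epsilon>
  proof (cases "V = 0")
    \<comment> \<open>Every width is 0, so each \<open>f i\<close> is constant and the centred sum
      vanishes.\<close>
    case True
    have "S w = 0" if w: "w \<in> space M" for w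
      unfolding S_def
    proof (intro sum.neutral ballI)
      fix i assume i: "i \<in> {1..n}"
      have "b i = a i"
        using True i unfolding V_def by (subst (asm) sum_nonneg_eq_0_iff) auto
      then have const: "f i x = a i" if "x \<in> space B" for x
        using assms(8)[OF i that] by simp
      then have "\<mu> i = expectation (\<lambda>_. a i)"
        unfolding \<mu>_def by (intro Bochner_Integration.integral_cong) auto
      then show "f i (X i w) - \<mu> i = 0"
        using const[OF measurable_space[OF X w]] i by (simp add: prob_space)
    qed
    then have "{w \<in> space M. \<epsilon> < \<bar>S w\<bar>} = {}"
      using \<epsilon> by auto
    then have "measure M {w \<in> space M. \<epsilon> < \<bar>S w\<bar>} = 0"
      by (simp only: measure_empty)
    with True show ?thesis
      by simp
  next
    case False
    moreover have "V \<ge> 0"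
      by (simp add: V_def sum_nonneg)
    ultimately have "\<alpha> * V > 0"
      using \<alpha> by simp
    then have "measure M {w \<in> space M. \<epsilon> < \<bar>S w\<bar>} \<le> 2 * exp (- (\<epsilon>\<^sup>2 / (2 * (\<alpha> * V))))"
      by (rule M.subgaussian_two_sided_tail[OF _ \<epsilon> S_meas mgf(1) mgf'])
    also have "\<epsilon>\<^sup>2 / (2 * (\<alpha> * V)) = inverse \<alpha> * \<epsilon>\<^sup>2 / (2 * V)"
      by (simp add: inverse_eq_divide mult.left_commute)
    finally show ?thesis
      using False by simp
  qed
  show ?thesis
    using sub_gaussian mgf[unfolded S_def] tail[unfolded S_eq]
    unfolding \<mu>_def V_def \<alpha>_def by blast
qed

end
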